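(* Let $d\ge 3$. (1) There exists a constant $C_d>0$ depending only on $d$ such that for every $N\ge1$ and every $X\subset\mathbb{Z}^d$ with $\#X=N$: if $\mathrm{cap}_N(X)=m_N$, then $P_N(X)\le C_d$. (2) Let $R>0$. There exists a constant $C_{d,R}>0$ depending only on $d$ and $R$ such that for every $N\ge1$ and every $X\subset B_{RN^{1/d}}\cap\mathbb{Z}^d$ with $\#X=N$: if $\mathrm{cap}_N(X,R)=m_N(R)$, then $P_N(X)\le C_{d,R}$.
   Context: $B_r$ is the open Euclidean ball of radius $r$ in $\mathbb{R}^d$ centred at $0$. For $u\colon\mathbb{Z}^d\to\mathbb{R}$ set $$E_N(u)=N^{\frac{2-d}{d}}\sum_{(i,j)\in(\mathbb{Z}^d)^2,\ |i-j|=1}|u(i)-u(j)|^2 .$$ For $X\subset\mathbb{Z}^d$ with $\#X=N$, the discrete capacity is $$\mathrm{cap}_N(X)=\inf\{E_N(u): u\colon\mathbb{Z}^d\to\mathbb{R},\ \#\mathrm{supp}(u)<+\infty,\ u\ge 1\text{ on }X\},$$ and $m_N=\inf\{\mathrm{cap}_N(X): X\subset\mathbb{Z}^d,\ \#X=N\}$. For $R>0$ and $X\subset B_{RN^{1/d}}\cap\mathbb{Z}^d$ with $\#X=N$, the discrete relative capacity is $$\mathrm{cap}_N(X,R)=\inf\{E_N(u): u\colon\mathbb{Z}^d\to\mathbb{R},\ \mathrm{supp}(u)\subset B_{RN^{1/d}},\ u\ge 1\text{ on }X\},$$ and $m_N(R)=\inf\{\mathrm{cap}_N(X,R): X\subset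 B_{RN^{1/d}}\cap\mathbb{Z}^d,\ \#X=N\}$. The edge perimeter of $X$ with $\#X=N$ is $P(X)=\sum_{i\in X}\#\{j\in\mathbb{Z}^d\setminus X: |i-j|=1\}$, and its scaled version is $P_N(X)=N^{\frac{1-d}{d}}P(X)$. *)

theory Defs
  imports "HOL-Analysis.Analysis"
begin

text \<open>
  The lattice \<open>\<int>\<^sup>d\<close> is the type \<open>int ^ 'd\<close>, with \<open>d = CARD('d)\<close>; Euclidean lengths of lattice
  points are measured in \<open>real ^ 'd\<close>.
\<close>

definition real_vec :: "int ^ 'd \<Rightarrow> real ^ 'd" where
  "real_vec i = (\<chi> k. real_of_int (i $ k))"

definition adjacent :: "int ^ 'd \<Rightarrow> int ^ 'd \<Rightarrow> bool" where
  "adjacent i j \<longleftrightarrow> norm (real_vec (i - j)) = 1"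

definition supp :: "(int ^ 'd \<Rightarrow> real) \<Rightarrow> (int ^ 'd) set" where
  "supp u = {i. u i \<noteq> 0}"

text \<open>
  The sum ranges over ordered pairs, so every edge is counted twice.  \<open>infsum\<close> over the reals is
  \<open>0\<close> for a non-summable family; the energy is only evaluated below at functions of finite support,
  for which only finitely many summands are nonzero (lemma \<open>energy_summable\<close>).
\<close>

definition energy :: "nat \<Rightarrow> (int ^ 'd \<Rightarrow> real) \<Rightarrow> real" where
  "energy N u =
     real N powr ((2 - real CARD('d)) / real CARD('d)) *
     (\<Sum>\<^sub>\<infinity>(i, j)\<in>{(i, j). adjacent i j}. \<bar>u i - u j\<bar>\<^sup>2)"

definition cap :: "nat \<Rightarrow> (int ^ 'd) set \<Rightarrow> real" where
  "cap N X = Inf {energy N u | u. finite (supp u) \<and> (\<forall>i\<in>X. u i \<ge> 1)}"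

text \<open>The argument of type \<open>'d itself\<close> records the dimension.\<close>

definition min_cap :: "'d::finite itself \<Rightarrow> nat \<Rightarrow> real" where
  "min_cap _ N = Inf {cap N X | X :: (int ^ 'd) set. finite X \<and> card X = N}"

definition lattice_ball :: "nat \<Rightarrow> real \<Rightarrow> (int ^ 'd) set" where
  "lattice_ball N R = {i. real_vec i \<in> ball 0 (R * real N powr (1 / real CARD('d)))}"

definition rel_cap :: "nat \<Rightarrow> (int ^ 'd) set \<Rightarrow> real \<Rightarrow> real" where
  "rel_cap N X R = Inf {energy N u | u. supp u \<subseteq> lattice_ball N R \<and> (\<forall>i\<in>X. u i \<ge> 1)}"

text \<open>
  If the ball contains fewer than \<open>N\<close> lattice points, the infimum below is over the empty set and
  its value is unspecified; there is then no competitor \<open>X\<close> to compare with it.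
\<close>

definition min_rel_cap :: "'d::finite itself \<Rightarrow> nat \<Rightarrow> real \<Rightarrow> real" where
  "min_rel_cap _ N R =
     Inf {rel_cap N X R | X :: (int ^ 'd) set. X \<subseteq> lattice_ball N R \<and> finite X \<and> card X = N}"

definition edge_perimeter :: "(int ^ 'd) set \<Rightarrow> nat" where
  "edge_perimeter X = (\<Sum>i\<in>X. card {j. j \<notin> X \<and> adjacent i j})"

definition scaled_perimeter :: "nat \<Rightarrow> (int ^ 'd) set \<Rightarrow> real" where
  "scaled_perimeter N X =
     real N powr ((1 - real CARD('d)) / real CARD('d)) * real (edge_perimeter X)"

lemma finite_bounded_lattice: "finite {i :: int ^ 'd. norm (real_vec (i - a)) \<le> r}"
proof -
  let ?B = "{x. \<bar>real_of_int x\<bar> \<le> r}"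
  have fB: "finite ?B"
    by (rule finite_subset[of _ "{-\<lceil>r\<rceil>..\<lceil>r\<rceil>}"]) (auto, linarith+)
  have "finite {v :: int ^ 'd. \<forall>k. v $ k \<in> ?B}"
    by (rule finite_subset[of _ "vec_lambda ` (UNIV \<rightarrow>\<^sub>E ?B)"])
       (use fB in \<open>auto intro!: finite_imageI finite_PiE rev_image_eqI[of "vec_nth _"]\<close>)
  moreover have "(\<lambda>i. i - a) ` {i. norm (real_vec (i - a)) \<le> r} \<subseteq> {v. \<forall>k. v $ k \<in> ?B}"
    using component_le_norm_cart order_trans by (fastforce simp: real_vec_def)
  ultimately have "finite ((\<lambda>i. i - a) ` {i. norm (real_vec (i - a)) \<le> r})"
    by (rule rev_finite_subset)
  then show ?thesis
    by (rule finite_imageD) (auto simp: inj_on_def)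
qed

lemma adjacent_sym: "adjacent i j \<longleftrightarrow> adjacent j i"
proof -
  have "real_vec (i - j) = - real_vec (j - i)"
    by (simp add: real_vec_def vec_eq_iff)
  then show ?thesis
    by (simp add: adjacent_def)
qed

lemma finite_neighbours: "finite {j. adjacent i j}"
  by (rule finite_subset[OF _ finite_bounded_lattice[of i 1]])
     (use adjacent_sym[of i] in \<open>auto simp: adjacent_def\<close>)

lemma finite_lattice_ball: "finite (lattice_ball N R)"
  by (rule finite_subset[OF _ finite_bounded_lattice[of 0 "R * real N powr (1 / real CARD('a))"]])
     (auto simp: lattice_ball_def)

lemma energy_summable:
  assumes "finite (supp u)"
  shows "(\<lambda>(i, j). \<bar>u i - u j\<bar>\<^sup>2) summable_on {(i, j). adjacent i j}"
proof -
  let ?S = "Sigma (supp u) (\<lambda>i. {j. adjacent i j})"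
  let ?T = "?S \<union> prod.swap ` ?S"
  have "finite ?T"
    using assms by (auto intro!: finite_SigmaI finite_neighbours)
  then have "(\<lambda>(i, j). \<bar>u i - u j\<bar>\<^sup>2) summable_on ?T"
    by (rule summable_on_finite)
  moreover have "?T \<subseteq> {(i, j). adjacent i j}"
    by (auto dest: adjacent_sym[THEN iffD1])
  moreover have "(case p of (i, j) \<Rightarrow> \<bar>u i - u j\<bar>\<^sup>2) = 0"
    if "p \<in> {(i, j). adjacent i j} - ?T" for p
    using that by (force simp: supp_def image_iff dest: adjacent_sym[THEN iffD1])
  ultimately show ?thesis
    by (subst summable_on_cong_neutral[where T = ?T]) auto
qed

end

(*
  Let u be the equilibrium potential of a minimiser X, and let N = s^d.  Moving a point of X from i
  to j does not decrease the capacity; testing this with an explicit competitor bounds the charge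
  lap u i by a multiple of the jump 1 - u j, for all i in X and j outside X.  The charges sum up to
  the Dirichlet energy, which is O(s^(d - 2)), so the perimeter is O(s^(d - 1)) as soon as one point
  of X carries a charge of order 1 / s.

  In the whole space, if all charges are at most H, the maximum principle applied to the discrete
  gradient makes u an H-Lipschitz function, hence at least 1 / 2 on a ball of radius of order 1 / H;
  a discrete Hardy inequality (d >= 3) then bounds the energy below by a multiple of H^(2 - d).
  In a ball of volume greater than N, a quadratic barrier shows that the point of X farthest from
  the origin has a large charge.  Otherwise X misses so few lattice points that the bound
  is trivial.
*)
theory Submission
  imports Defs
begin

section \<open>Discrete Laplacian and Dirichlet form\<close>

text \<open>A single large charge is enough because the swap estimate holds for all pairs: one fixed
  \<open>i\<close> forces 1 - u j to be at least of order 1 / s at every \<open>j\<close> outside X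
  at once. Each boundary edge then takes a share of order 1 / s of the total flux, and this limits
  the number of edges. The competitor alters \<open>u\<close> only at \<open>i\<close> and
  \<open>j\<close>; gain and cost are both quadratic, so charge and jump are compared at first
  power. Two obstacles shape the rest. In the whole space the infimum is not attained, so the swap
  estimate carries a slack that vanishes along an exhaustion, and the maximum principle for the
  gradient needs a substitute for decay at infinity: finite energy leaves only finitely many steep
  edges. In a ball, the uniform energy bound comes from a strictly smaller concentric ball that
  still holds N points, which leaves a layer of width of order s for a cutoff; this is why the
  volume is compared with N.\<close>

definition steps :: "(int ^ 'd) set" where
  "steps = {e. norm (real_vec e) = 1}"

text \<open>Minus the usual graph Laplacian: subharmonic means \<open>lap u x \<le> 0\<close>, and
  the charge of a potential on \<open>X\<close> is nonnegative.\<close>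

definition lap :: "(int ^ 'd \<Rightarrow> real) \<Rightarrow> int ^ 'd \<Rightarrow> real" where
  "lap u x = (\<Sum>e\<in>steps. u x - u (x + e))"

text \<open>For finite support this is half of the sum over ordered pairs in \<open>energy\<close>,
  after summation by parts (\<open>two_dirichlet\<close>). In this form first and second variations
  can be read off.\<close>

definition dirichlet :: "(int ^ 'd \<Rightarrow> real) \<Rightarrow> real" where
  "dirichlet u = (\<Sum>x\<in>supp u. u x * lap u x)"

lemma real_vec_nth [simp]: "real_vec x $ k = real_of_int (x $ k)"
  by (simp add: real_vec_def)

lemma real_vec_add: "real_vec (x + y) = real_vec x + real_vec y"
  by (simp add: vec_eq_iff)

lemma real_vec_minus: "real_vec (- x) = - real_vec x"
  by (simp add: vec_eq_iff)

lemma real_vec_zero [simp]: "real_vec 0 = 0"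
  by (simp add: vec_eq_iff)

lemma norm_real_vec_sq: "norm (real_vec x) ^ 2 = (\<Sum>k\<in>UNIV. real_of_int (x $ k) ^ 2)"
  by (simp add: norm_vec_def L2_set_def sum_nonneg)

lemma real_vec_axis: "real_vec (axis k a) = axis k (real_of_int a)"
  by (simp add: vec_eq_iff axis_def)

lemma adjacent_iff_steps: "adjacent i j \<longleftrightarrow> j - i \<in> steps"
  by (subst adjacent_sym) (simp add: adjacent_def steps_def)

lemma axis_minus: "axis k (- a :: real) = - axis k a"
  by (simp add: vec_eq_iff axis_def)

lemma adjacent_add_iff [simp]: "adjacent i (i + e) \<longleftrightarrow> e \<in> steps"
  by (simp add: adjacent_iff_steps)

lemma finite_steps [simp]: "finite (steps :: (int ^ 'd) set)"
  using finite_neighbours[of "0 :: int ^ 'd"] by (simp add: adjacent_iff_steps)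

lemma uminus_steps_iff [simp]: "- e \<in> steps \<longleftrightarrow> e \<in> steps"
  by (simp add: steps_def real_vec_minus)

lemma norm_steps: "e \<in> steps \<Longrightarrow> norm (real_vec e) = 1"
  by (simp add: steps_def)

lemma sum_steps_uminus: "(\<Sum>e\<in>steps. f (- e)) = (\<Sum>e\<in>steps. f e)"
  by (rule sum.reindex_bij_witness[of _ uminus uminus]) auto

text \<open>Squares of integers that add up to 1 have exactly one nonzero term.\<close>

lemma steps_eq: "(steps :: (int ^ 'd) set)
    = range (\<lambda>k. axis k 1) \<union> range (\<lambda>k. axis k (- 1))"
proof (intro subset_antisym subsetI)
  fix e :: "int ^ 'd"
  assume "e \<in> steps"
  then have "(\<Sum>k\<in>UNIV. real_of_int (e $ k) ^ 2) = 1"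
    by (simp flip: norm_real_vec_sq add: norm_steps)
  then have "real_of_int (\<Sum>k\<in>UNIV. (e $ k) ^ 2) = real_of_int 1"
    by simp
  then have s: "(\<Sum>k\<in>UNIV. (e $ k) ^ 2) = 1"
    by (simp only: of_int_eq_iff)
  then obtain k where k: "e $ k \<noteq> 0"
    by (metis (no_types, lifting) sum.neutral zero_eq_power2 zero_neq_one)
  have "(e $ k) ^ 2 + (\<Sum>l\<in>UNIV - {k}. (e $ l) ^ 2) = 1"
    using s by (subst (asm) sum.remove[of _ k]) auto
  moreover have "(e $ k) ^ 2 \<ge> 1"
    using k by (smt (verit) zero_less_power2)
  moreover have "(\<Sum>l\<in>UNIV - {k}. (e $ l) ^ 2) \<ge> 0"
    by (simp add: sum_nonneg)
  ultimately have e1: "(e $ k) ^ 2 = 1" and "(\<Sum>l\<in>UNIV - {k}. (e $ l) ^ 2) = 0"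
    by linarith+
  then have e0: "e $ l = 0" if "l \<noteq> k" for l
    using that by (subst (asm) sum_nonneg_eq_0_iff) auto
  from e1 have "e $ k = 1 \<or> e $ k = - 1"
    by (simp add: power2_eq_1_iff)
  then have "e = axis k 1 \<or> e = axis k (- 1)"
    using e0 by (auto simp: vec_eq_iff axis_def)
  then show "e \<in> range (\<lambda>k. axis k 1) \<union> range (\<lambda>k. axis k (- 1))"
    by auto
next
  fix e :: "int ^ 'd"
  assume "e \<in> range (\<lambda>k. axis k 1) \<union> range (\<lambda>k. axis k (- 1))"
  then show "e \<in> steps"
    by (auto simp: steps_def real_vec_axis norm_axis_1 axis_minus)
qed

lemma sum_steps:
  fixes f :: "int ^ 'd \<Rightarrow> 'b::comm_monoid_add"
  shows "(\<Sum>e\<in>steps. f e) = (\<Sum>k\<in>UNIV. f (axis k 1) + f (axis k (- 1)))"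
proof -
  have ax: "axis k a = (axis l b :: int ^ 'd) \<longleftrightarrow> k = l \<and> a
      = b" if "a \<noteq> 0" for k l a b
    using that by (auto simp: axis_eq_axis)
  have "(\<Sum>e\<in>steps. f e) =
      (\<Sum>e\<in>range (\<lambda>k. axis k 1). f e) + (\<Sum>e\<in>range (\<lambda>k. axis k (- 1)). f e)"
    unfolding steps_eq by (rule sum.union_disjoint) (auto simp: ax)
  also have "\<dots> = (\<Sum>k\<in>UNIV. f (axis k 1)) + (\<Sum>k\<in>UNIV. f (axis k (- 1)))"
    by (subst (1 2) sum.reindex) (auto simp: ax inj_on_def)
  finally show ?thesis
    by (simp add: sum.distrib)
qed

lemma card_steps: "card (steps :: (int ^ 'd) set) = 2 * CARD('d)"
proof -
  have "card (steps :: (int ^ 'd) set) = (\<Sum>e\<in>(steps :: (int ^ 'd) set). 1)"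
    by simp
  then show ?thesis
    unfolding sum_steps by simp
qed

lemma inner_axis_real_vec: "real_vec x \<bullet> real_vec (axis k a)
    = real_of_int a * real_of_int (x $ k)"
  by (simp add: real_vec_axis inner_axis)

lemma norm_real_vec_add_sq:
  "norm (real_vec (x + e)) ^ 2 = norm (real_vec x) ^ 2 + 2 * (real_vec x \<bullet> real_vec e) + norm (real_vec e) ^ 2"
  by (simp add: real_vec_add power2_norm_eq_inner inner_add_left inner_add_right inner_commute)

lemma supp_subset_iff: "supp u \<subseteq> A \<longleftrightarrow> (\<forall>x. x \<notin> A
    \<longrightarrow> u x = 0)"
  by (auto simp: supp_def)

lemma sum_shift:
  fixes f g :: "int ^ 'd \<Rightarrow> real"
  assumes "finite A" "supp f \<subseteq> A" "supp g \<subseteq> A"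
  shows "(\<Sum>x\<in>A. f x * g (x + e)) = (\<Sum>x\<in>A. g x * f (x - e))"
proof -
  have "(\<Sum>x\<in>A. f x * g (x + e)) = (\<Sum>x\<in>{x \<in> A. x + e \<in> A}. f x * g (x + e))"
    using assms by (intro sum.mono_neutral_right) (auto simp: supp_subset_iff)
  also have "\<dots> = (\<Sum>x\<in>{x \<in> A. x - e \<in> A}. g x * f (x - e))"
    by (rule sum.reindex_bij_witness[of _ "\<lambda>x. x - e" "\<lambda>x. x + e"]) auto
  also have "\<dots> = (\<Sum>x\<in>A. g x * f (x - e))"
    using assms by (intro sum.mono_neutral_left) (auto simp: supp_subset_iff)
  finally show ?thesis .
qed

lemma lap_eq: "lap u x = real (card (steps :: (int ^ 'd) set)) * u x - (\<Sum>e\<in>steps. u (x + e))"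
  for u :: "int ^ 'd \<Rightarrow> real"
  by (simp add: lap_def sum_subtractf)

lemma lap_add: "lap (\<lambda>x. u x + v x) x = lap u x + lap v x"
  unfolding lap_def sum.distrib[symmetric] by (rule sum.cong) auto

lemma lap_diff: "lap (\<lambda>x. u x - v x) x = lap u x - lap v x"
  unfolding lap_def sum_subtractf[symmetric] by (rule sum.cong) auto

lemma lap_shift: "lap (\<lambda>x. u (x + a)) x = lap u (x + a)"
  by (simp add: lap_def algebra_simps)

text \<open>Steps occur in opposite pairs, so moving each shift to the other factor gives the same
  operator back. There are no boundary terms because both functions vanish outside
  \<open>A\<close>.\<close>

lemma green:
  fixes f g :: "int ^ 'd \<Rightarrow> real"
  assumes "finite A" "supp f \<subseteq> A" "supp g \<subseteq> A"
  shows "(\<Sum>x\<in>A. f x * lap g x) = (\<Sum>x\<in>A. g x * lap f x)"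
proof -
  have "(\<Sum>x\<in>A. \<Sum>e\<in>steps. f x * g (x + e))
      = (\<Sum>e\<in>steps. \<Sum>x\<in>A. g x * f (x + (- e)))"
    using assms by (subst sum.swap) (simp add: sum_shift)
  also have "\<dots> = (\<Sum>x\<in>A. \<Sum>e\<in>steps. g x * f (x + e))"
    by (subst sum_steps_uminus) (rule sum.swap)
  finally show ?thesis
    by (simp add: lap_eq right_diff_distrib sum_subtractf sum_distrib_left mult_ac)
qed

lemma dirichlet_eq:
  assumes "finite A" "supp u \<subseteq> A"
  shows "dirichlet u = (\<Sum>x\<in>A. u x * lap u x)"
  unfolding dirichlet_def using assms
  by (intro sum.mono_neutral_left) (auto simp: supp_def)

lemma dirichlet_add:
  assumes "finite A" "supp u \<subseteq> A" "supp v \<subseteq> A"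
  shows "dirichlet (\<lambda>x. u x + v x)
      = dirichlet u + 2 * (\<Sum>x\<in>A. v x * lap u x) + dirichlet v"
proof -
  have "supp (\<lambda>x. u x + v x) \<subseteq> A"
    using assms by (auto simp: supp_subset_iff)
  then have "dirichlet (\<lambda>x. u x + v x) =
      (\<Sum>x\<in>A. u x * lap u x) + (\<Sum>x\<in>A. u x * lap v x) + (\<Sum>x\<in>A. v x * lap u x) + (\<Sum>x\<in>A. v x * lap v x)"
    using assms by (simp add: dirichlet_eq lap_add algebra_simps sum.distrib)
  then show ?thesis
    using assms green[of A u v] by (simp add: dirichlet_eq)
qed

text \<open>After expanding the square, the terms u (x + e)^2 must resum to the terms u x^2. Hence
  \<open>A\<close> contains the neighbours of the support: an edge leaving it is also counted from
  its outer endpoint.\<close>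

lemma two_dirichlet:
  fixes u :: "int ^ 'd \<Rightarrow> real"
  assumes "finite A" "supp u \<subseteq> A" "\<forall>x\<in>supp u. \<forall>e\<in>steps. x + e \<in> A"
  shows "2 * dirichlet u = (\<Sum>x\<in>A. \<Sum>e\<in>steps. (u x - u (x + e)) ^ 2)"
proof -
  have sq: "(\<Sum>x\<in>A. u (x + e) ^ 2) = (\<Sum>x\<in>A. u x ^ 2)" if "e \<in> steps" for e
  proof -
    have "(\<Sum>x\<in>A. u (x + e) ^ 2) = (\<Sum>x\<in>{x. x + e \<in> supp u}. u (x + e) ^ 2)"
    proof (rule sum.mono_neutral_right)
      show "{x. x + e \<in> supp u} \<subseteq> A"
        using assms(3) that
          by (metis (no_types, lifting) add_diff_cancel add_uminus_conv_diff mem_Collect_eq subsetI uminus_steps_iff)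
    qed (use assms in \<open>auto simp: supp_def\<close>)
    also have "\<dots> = (\<Sum>x\<in>supp u. u x ^ 2)"
      by (rule sum.reindex_bij_witness[of _ "\<lambda>x. x - e" "\<lambda>x. x + e"]) auto
    also have "\<dots> = (\<Sum>x\<in>A. u x ^ 2)"
      using assms by (intro sum.mono_neutral_left) (auto simp: supp_def)
    finally show ?thesis .
  qed
  have "(\<Sum>x\<in>A. \<Sum>e\<in>steps. (u x - u (x + e)) ^ 2) =
      (\<Sum>e\<in>steps. \<Sum>x\<in>A. u x ^ 2 + u (x + e) ^ 2 - 2 * (u x * u (x + e)))"
    by (subst sum.swap) (simp add: power2_diff algebra_simps)
  also have "\<dots> = (\<Sum>e\<in>steps. \<Sum>x\<in>A. 2 * (u x * (u x - u (x + e))))"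
  proof (rule sum.cong)
    fix e :: "int ^ 'd"
    assume "e \<in> steps"
    then have "(\<Sum>x\<in>A. u x ^ 2 + u (x + e) ^ 2 - 2 * (u x * u (x + e))) =
        (\<Sum>x\<in>A. u x ^ 2) + (\<Sum>x\<in>A. u x ^ 2) - (\<Sum>x\<in>A. 2 * (u x * u (x + e)))"
      by (simp add: sum.distrib sum_subtractf sq)
    also have "\<dots> = (\<Sum>x\<in>A. 2 * (u x * (u x - u (x + e))))"
      unfolding sum.distrib[symmetric] sum_subtractf[symmetric]
      by (rule sum.cong) (simp_all add: algebra_simps power2_eq_square)
    finally show "(\<Sum>x\<in>A. u x ^ 2 + u (x + e) ^ 2 - 2 * (u x * u (x + e))) =
        (\<Sum>x\<in>A. 2 * (u x * (u x - u (x + e))))" .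
  qed simp
  also have "\<dots> = 2 * dirichlet u"
    using assms(1,2)
    by (subst sum.swap) (simp add: dirichlet_eq lap_def sum_distrib_left)
  finally show ?thesis by simp
qed

lemma ex_neighbourhood:
  fixes u :: "int ^ 'd \<Rightarrow> real"
  assumes "finite (supp u)" "finite F"
  obtains A where "finite A" "F \<subseteq> A" "supp u \<subseteq> A" "\<forall>x\<in>supp u. \<forall>e\<in>steps. x + e \<in> A"
proof
  let ?A = "F \<union> supp u \<union> (\<lambda>(x, e). x + e) ` (supp u \<times> steps)"
  show "finite ?A"
    using assms by auto
qed auto

text \<open>\<open>F\<close> is unrelated to the support, so the bound can be used on a fixed finite
  set while the supports grow along an exhaustion.\<close>

lemma sum_gradient_le_dirichlet:
  fixes u :: "int ^ 'd \<Rightarrow> real"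
  assumes "finite (supp u)" "finite F"
  shows "(\<Sum>x\<in>F. \<Sum>e\<in>steps. (u x - u (x + e)) ^ 2) \<le> 2 * dirichlet u"
proof -
  obtain A where A: "finite A" "F \<subseteq> A" "supp u \<subseteq> A"
      "\<forall>x\<in>supp u. \<forall>e\<in>steps. x + e \<in> A"
    by (metis ex_neighbourhood assms)
  have "(\<Sum>x\<in>F. \<Sum>e\<in>steps. (u x - u (x + e)) ^ 2)
      \<le> (\<Sum>x\<in>A. \<Sum>e\<in>steps. (u x - u (x + e)) ^ 2)"
    using A by (intro sum_mono2) (auto intro: sum_nonneg)
  then show ?thesis
    using A by (simp add: two_dirichlet[of A])
qed

lemma dirichlet_nonneg:
  assumes "finite (supp u)"
  shows "dirichlet u \<ge> 0"
  using sum_gradient_le_dirichlet[OF assms, of "{}"] by simp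

lemma energy_eq_dirichlet:
  fixes u :: "int ^ 'd \<Rightarrow> real"
  assumes "finite (supp u)"
  shows "energy N u = real N powr ((2 - real CARD('d)) / real CARD('d)) * (2 * dirichlet u)"
proof -
  obtain A where A: "finite A" "supp u \<subseteq> A"
      "\<forall>x\<in>supp u. \<forall>e\<in>steps. x + e \<in> A"
    by (metis ex_neighbourhood assms finite.emptyI)
  have "(\<Sum>\<^sub>\<infinity>(i, j)\<in>{(i, j). adjacent i j}. \<bar>u i - u j\<bar>\<^sup>2) =
      (\<Sum>\<^sub>\<infinity>(i, j)\<in>Sigma A (\<lambda>i. {j. adjacent i j}). \<bar>u i - u j\<bar>\<^sup>2)"
  proof (rule infsum_cong_neutral)
    fix p :: "(int ^ 'd) \<times> (int ^ 'd)"
    assume p: "p \<in> {(i, j). adjacent i j} - Sigma A (\<lambda>i. {j. adjacent i j})"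
    obtain i j where ij: "p = (i, j)" by force
    have "adjacent j i" "i \<notin> A"
      using p by (auto simp: ij adjacent_sym[of j i])
    then have "i - j \<in> steps" "i \<notin> A"
      by (simp_all add: adjacent_iff_steps)
    then have "i \<notin> supp u" "j \<notin> supp u"
      using A(2) A(3)[rule_format, of j "i - j"] by (auto simp del: adjacent_add_iff)
    then show "(case p of (i, j) \<Rightarrow> \<bar>u i - u j\<bar>\<^sup>2) = 0"
      by (simp add: ij supp_def)
  next
    fix p :: "(int ^ 'd) \<times> (int ^ 'd)"
    assume "p \<in> Sigma A (\<lambda>i. {j. adjacent i j}) - {(i, j). adjacent i j}"
    then show "(case p of (i, j) \<Rightarrow> \<bar>u i - u j\<bar>\<^sup>2) = 0"
      by auto
  qed (rule refl)
  also have "\<dots> = (\<Sum>(i, j)\<in>Sigma A (\<lambda>i. {j. adjacent i j}). \<bar>u i - u j\<bar>\<^sup>2)"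
    using A(1) by (intro infsum_finite) (auto intro: finite_neighbours)
  also have "\<dots> = (\<Sum>i\<in>A. \<Sum>j\<in>{j. adjacent i j}. (u i - u j)\<^sup>2)"
    using A(1) by (subst sum.Sigma[symmetric]) (auto intro: finite_neighbours)
  also have "\<dots> = (\<Sum>i\<in>A. \<Sum>e\<in>steps. (u i - u (i + e))\<^sup>2)"
  proof (rule sum.cong)
    fix i
    show "(\<Sum>j\<in>{j. adjacent i j}. (u i - u j)\<^sup>2)
        = (\<Sum>e\<in>steps. (u i - u (i + e))\<^sup>2)"
      by (rule sum.reindex_bij_witness[of _ "\<lambda>e. i + e" "\<lambda>j. j - i"]) (auto simp: adjacent_iff_steps)
  qed simp
  also have "\<dots> = 2 * dirichlet u"
    using A by (simp add: two_dirichlet)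
  finally show ?thesis
    by (simp add: energy_def)
qed

text \<open>The factor 4 d bounds the operator norm of \<open>lap\<close> on square-summable
  functions. The correlation of \<open>u\<close> with a shift of itself is at least minus the sum of
  squares, because (u x + u (x + e))^2 is nonnegative.\<close>

lemma dirichlet_le_sum_sq:
  fixes u :: "int ^ 'd \<Rightarrow> real"
  assumes A: "finite A" "supp u \<subseteq> A"
  shows "dirichlet u \<le> 4 * real CARD('d) * (\<Sum>x\<in>A. u x ^ 2)"
proof -
  have "- (\<Sum>x\<in>A. u x ^ 2) \<le> (\<Sum>x\<in>A. u x * u (x + e))" for e
  proof -
    have "(\<Sum>x\<in>A. u (x + e) ^ 2) \<le> (\<Sum>x\<in>A. u x ^ 2)"
    proof -
      have "(\<Sum>x\<in>A. u (x + e) ^ 2) = (\<Sum>x\<in>{x \<in> A. x + e \<in> A}. u (x + e) ^ 2)"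
        using A by (intro sum.mono_neutral_right) (auto simp: supp_subset_iff)
      also have "\<dots> = (\<Sum>x\<in>{x \<in> A. x - e \<in> A}. u x ^ 2)"
        by (rule sum.reindex_bij_witness[of _ "\<lambda>x. x - e" "\<lambda>x. x + e"]) auto
      also have "\<dots> \<le> (\<Sum>x\<in>A. u x ^ 2)"
        using A by (intro sum_mono2) auto
      finally show ?thesis .
    qed
    moreover have "(\<Sum>x\<in>A. u x ^ 2) + 2 * (\<Sum>x\<in>A. u x * u (x + e)) + (\<Sum>x\<in>A. u (x + e) ^ 2)
        = (\<Sum>x\<in>A. (u x + u (x + e)) ^ 2)"
      by (simp add: power2_sum sum.distrib sum_distrib_left algebra_simps)
    moreover have "(\<Sum>x\<in>A. (u x + u (x + e)) ^ 2) \<ge> 0"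
      by (simp add: sum_nonneg)
    ultimately show ?thesis by linarith
  qed
  then have "(\<Sum>e\<in>(steps :: (int ^ 'd) set). - (\<Sum>x\<in>A. u x ^ 2))
      \<le> (\<Sum>e\<in>steps. \<Sum>x\<in>A. u x * u (x + e))"
    by (rule sum_mono)
  moreover have "dirichlet u = 2 * real CARD('d) * (\<Sum>x\<in>A. u x ^ 2) - (\<Sum>e\<in>steps. \<Sum>x\<in>A. u x * u (x + e))"
    using A by (subst sum.swap)
      (simp add: dirichlet_eq lap_eq card_steps sum_subtractf sum_distrib_left algebra_simps power2_eq_square)
  ultimately show ?thesis
    by (simp add: card_steps)
qed

section \<open>Lattice points in balls and the Hardy inequality\<close>

lemma norm_le_dim_of_components:
  fixes y :: "real ^ 'd"
  assumes "\<And>k. \<bar>y $ k\<bar> \<le> 1"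
  shows "norm y \<le> real CARD('d)"
proof -
  have "norm y \<le> (\<Sum>k\<in>UNIV. \<bar>y $ k\<bar>)"
    by (rule norm_le_l1_cart)
  also have "\<dots> \<le> (\<Sum>k\<in>(UNIV :: 'd set). 1)"
    using assms by (intro sum_mono) auto
  finally show ?thesis by simp
qed

lemma emeasure_unit_box:
  fixes x :: "real ^ 'd"
  shows "emeasure lborel (box x (x + 1)) = 1" "emeasure lborel (cbox x (x + 1)) = 1"
proof -
  have "\<And>b. b \<in> Basis \<Longrightarrow> (1 :: real ^ 'd) \<bullet> b = 1"
    by (auto simp: Basis_vec_def inner_axis)
  then show "emeasure lborel (box x (x + 1)) = 1" "emeasure lborel (cbox x (x + 1)) = 1"
    by (simp_all add: emeasure_lborel_box_eq emeasure_lborel_cbox_eq inner_add_left)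
qed

text \<open>Open unit cubes with lower corners at the lattice points are disjoint and stay in the
  ball enlarged by \<open>d\<close>, a crude bound for their diameter.\<close>

lemma card_le_volume:
  fixes r :: real
  assumes "r \<ge> 0"
  shows "real (card {x :: int ^ 'd. norm (real_vec x) \<le> r})
    \<le> unit_ball_vol (real CARD('d)) * (r + real CARD('d)) ^ CARD('d)"
proof -
  let ?S = "{x :: int ^ 'd. norm (real_vec x) \<le> r}"
  let ?Q = "\<lambda>x :: int ^ 'd. box (real_vec x) (real_vec x + 1)"
  have fin: "finite ?S"
    using finite_bounded_lattice[of "0 :: int ^ 'd" r] by simp
  have "disjoint_family_on ?Q ?S"
  unfolding disjoint_family_on_def
  proof (intro ballI impI)
    fix x y :: "int ^ 'd"
    assume "x \<noteq> y"
    then obtain k where k: "x $ k \<noteq> y $ k"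
      by (auto simp: vec_eq_iff)
    show "?Q x \<inter> ?Q y = {}"
    proof (rule ccontr)
      assume "?Q x \<inter> ?Q y \<noteq> {}"
      then obtain z where "z \<in> ?Q x" "z \<in> ?Q y" by blast
      then have "real_of_int (x $ k) < z $ k" "z $ k < real_of_int (x $ k) + 1"
        "real_of_int (y $ k) < z $ k" "z $ k < real_of_int (y $ k) + 1"
        by (auto simp: mem_box_cart)
      then show False using k by linarith
    qed
  qed
  then have "emeasure lborel (\<Union>x\<in>?S. ?Q x) = (\<Sum>x\<in>?S. emeasure lborel (?Q x))"
    using fin by (intro sum_emeasure[symmetric]) auto
  then have "ennreal (card ?S) = emeasure lborel (\<Union>x\<in>?S. ?Q x)"
    by (simp add: emeasure_unit_box ennreal_of_nat_eq_real_of_nat)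
  also have "\<dots> \<le> emeasure lborel (cball (0 :: real ^ 'd) (r + real CARD('d)))"
  proof (intro emeasure_mono subsetI)
    fix z assume "z \<in> (\<Union>x\<in>?S. ?Q x)"
    then obtain x where x: "norm (real_vec x) \<le> r" "z \<in> ?Q x" by blast
    have "norm (z - real_vec x) \<le> real CARD('d)"
      using x(2) by (intro norm_le_dim_of_components) (auto simp: mem_box_cart abs_le_iff less_imp_le diff_le_eq add.commute)
    then have "norm z \<le> r + real CARD('d)"
      using x(1) norm_triangle_sub[of z "real_vec x"] by linarith
    then show "z \<in> cball (0 :: real ^ 'd) (r + real CARD('d))" by simp
  qed auto
  also have "\<dots> = ennreal (unit_ball_vol (real CARD('d)) * (r + real CARD('d)) ^ CARD('d))"
    using assms by (subst emeasure_cball) simp_all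
  finally show ?thesis
    using assms by (subst (asm) ennreal_le_iff) auto
qed

text \<open>Rounding coordinates down puts every point of the smaller ball into one of the cubes.
  Only covering matters here, so the cubes are closed and subadditivity suffices.\<close>

lemma volume_le_card:
  fixes r :: real
  assumes "r \<ge> real CARD('d)"
  shows "unit_ball_vol (real CARD('d)) * (r - real CARD('d)) ^ CARD('d)
    \<le> real (card {x :: int ^ 'd. norm (real_vec x) < r})"
proof -
  let ?S = "{x :: int ^ 'd. norm (real_vec x) < r}"
  let ?Q = "\<lambda>x :: int ^ 'd. cbox (real_vec x) (real_vec x + 1)"
  have fin: "finite ?S"
    by (rule finite_subset[OF _ finite_bounded_lattice[of "0 :: int ^ 'd" r]]) auto
  have "ennreal (unit_ball_vol (real CARD('d)) * (r - real CARD('d)) ^ CARD('d)) =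
      emeasure lborel (ball (0 :: real ^ 'd) (r - real CARD('d)))"
    using assms by (subst emeasure_ball) simp_all
  also have "\<dots> \<le> emeasure lborel (\<Union>x\<in>?S. ?Q x)"
  proof (intro emeasure_mono subsetI)
    fix z :: "real ^ 'd"
    assume "z \<in> ball 0 (r - real CARD('d))"
    then have z: "norm z < r - real CARD('d)" by simp
    define x :: "int ^ 'd" where "x = (\<chi> k. \<lfloor>z $ k\<rfloor>)"
    have zx: "z \<in> ?Q x"
      by (auto simp: mem_box_cart x_def less_imp_le)
    then have "norm (real_vec x - z) \<le> real CARD('d)"
      by (intro norm_le_dim_of_components) (auto simp: mem_box_cart abs_le_iff diff_le_eq add.commute)
    then have "norm (real_vec x) < r"
      using z norm_triangle_sub[of "real_vec x" z] by linarith
    with zx show "z \<in> (\<Union>x\<in>?S. ?Q x)" by blast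
  qed (use fin in auto)
  also have "\<dots> \<le> (\<Sum>x\<in>?S. emeasure lborel (?Q x))"
    using fin by (intro emeasure_subadditive_finite) auto
  also have "\<dots> = ennreal (card ?S)"
    by (simp add: emeasure_unit_box ennreal_of_nat_eq_real_of_nat)
  finally show ?thesis
    by (subst (asm) ennreal_le_iff) auto
qed

text \<open>Contribution of the two opposite edges along one axis, where \<open>p\<close> is that
  coordinate of the point and \<open>Q\<close> changes by 1 + 2 p or 1 - 2 p. The denominator (3 Q +
  2)^2 of the bound does not involve \<open>p\<close>, so the contributions of all axes can be
  added.\<close>

lemma hardy_weight_pair:
  fixes A m p :: real
  assumes A: "A \<ge> 4" and p: "p ^ 2 \<le> m"
  defines "Q \<equiv> A + m"
  shows "(1 - (2 * Q + (Q + 2 * p + 1)) / (Q + 2 * (Q + 2 * p + 1)))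
    + (1 - (2 * Q + (Q - 2 * p + 1)) / (Q + 2 * (Q - 2 * p + 1)))
    \<ge> (2 * (3 * Q + 2) - 18 * p ^ 2) / (3 * Q + 2) ^ 2"
proof -
  define M where "M = 3 * Q + 2"
  have Q: "Q \<ge> 4 + p ^ 2" using A p by (simp add: Q_def)
  have p2: "2 * \<bar>p\<bar> \<le> 1 + p ^ 2"
    using zero_le_power2[of "\<bar>p\<bar> - 1"] by (simp add: power2_diff)
  have M1: "M + 4 * p > 0" "M - 4 * p > 0"
    using Q p2 by (auto simp: M_def abs_le_iff)
  then have den: "M ^ 2 - 16 * p ^ 2 > 0"
    using mult_pos_pos[OF M1] by (simp add: algebra_simps power2_eq_square)
  have M2: "M \<ge> 3 * (A + p ^ 2)" "M > 0"
    using p Q M1 by (auto simp: M_def Q_def)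
  \<comment> \<open>By the AM-GM inequality M^2 \<ge> 36 A p^2 \<ge> 144 p^2, which is the purpose
    of \<open>A \<ge> 4\<close>. Twice this absorbs the term 288 p^2 that arises from replacing the
    denominator M^2 - 16 p^2 by M^2.\<close>
  have "(3 * (A + p ^ 2)) ^ 2 \<ge> 36 * (A * p ^ 2)"
    using zero_le_power2[of "3 * (A - p ^ 2)"] by (simp add: power2_eq_square algebra_simps)
  moreover have "M ^ 2 \<ge> (3 * (A + p ^ 2)) ^ 2"
    using M2 A by (intro power_mono) auto
  moreover have "A * p ^ 2 \<ge> 4 * p ^ 2"
    using A by (intro mult_right_mono) auto
  ultimately have key: "2 * M ^ 2 + 32 * M - 288 * p ^ 2 \<ge> 0"
    using M2 by linarith
  have "(1 - (2 * Q + (Q + 2 * p + 1)) / (Q + 2 * (Q + 2 * p + 1)))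
    + (1 - (2 * Q + (Q - 2 * p + 1)) / (Q + 2 * (Q - 2 * p + 1)))
    = (2 * p + 1) / (M + 4 * p) + (1 - 2 * p) / (M - 4 * p)"
  proof -
    have "Q + 2 * (Q + 2 * p + 1) = M + 4 * p" "Q + 2 * (Q - 2 * p + 1) = M - 4 * p"
      by (simp_all add: M_def)
    moreover have "1 - (2 * Q + (Q + 2 * p + 1)) / (M + 4 * p) = (2 * p + 1) / (M + 4 * p)"
      "1 - (2 * Q + (Q - 2 * p + 1)) / (M - 4 * p) = (1 - 2 * p) / (M - 4 * p)"
      using M1 by (simp_all add: divide_simps) (simp_all add: M_def)
    ultimately show ?thesis by (simp only:)
  qed
  also have "\<dots> = (2 * M - 16 * p ^ 2) / (M ^ 2 - 16 * p ^ 2)"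
  proof -
    have "(2 * p + 1) / (M + 4 * p) + (1 - 2 * p) / (M - 4 * p)
       = ((2 * p + 1) * (M - 4 * p) + (1 - 2 * p) * (M + 4 * p)) / ((M + 4 * p) * (M - 4 * p))"
      using M1 by (simp add: add_frac_eq)
    then show ?thesis by (simp add: algebra_simps power2_eq_square)
  qed
  finally have eq: "(1 - (2 * Q + (Q + 2 * p + 1)) / (Q + 2 * (Q + 2 * p + 1)))
    + (1 - (2 * Q + (Q - 2 * p + 1)) / (Q + 2 * (Q - 2 * p + 1)))
    = (2 * M - 16 * p ^ 2) / (M ^ 2 - 16 * p ^ 2)" .
  have "(2 * M - 16 * p ^ 2) * M ^ 2 - (2 * M - 18 * p ^ 2) * (M ^ 2 - 16 * p ^ 2)
      = p ^ 2 * (2 * M ^ 2 + 32 * M - 288 * p ^ 2)"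
    by algebra
  also have "\<dots> \<ge> 0"
    using key by simp
  finally have "(2 * M - 18 * p ^ 2) / M ^ 2 \<le> (2 * M - 16 * p ^ 2) / (M ^ 2 - 16 * p ^ 2)"
    using den M2 by (simp add: frac_le_eq mult_nonneg_nonneg divide_le_0_iff)
  then show ?thesis
    unfolding eq M_def .
qed

text \<open>
  With \<open>Q x = A + |x|\<^sup>2\<close>, the edge weights \<open>r(x, y)
      = (2 Q x + Q y) / (Q x + 2 Q y)\<close> are a rational
  substitute for \<open>g y / g x\<close>, where \<open>g
      = Q powr (- 1 / 3)\<close> is a positive supersolution.  All that
  the ground state argument uses is \<open>r(x, y) * r(y, x) = 1\<close>, which gives
  \<open>2 v(x) v(y) \<le> r(x, y) v(x)\<^sup>2 + r(y, x) v(y)\<^sup>2\<close> on every edge.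
\<close>

lemma hardy:
  fixes v :: "int ^ 'd \<Rightarrow> real"
  assumes d: "CARD('d) \<ge> 3" and A: "A \<ge> 4" and fin: "finite (supp v)"
  shows "(\<Sum>x\<in>supp v. v x ^ 2 * (18 * A / (3 * (A + norm (real_vec x) ^ 2) + 2) ^ 2))
      \<le> dirichlet v"
proof -
  define Q where "Q = (\<lambda>x :: int ^ 'd. A + norm (real_vec x) ^ 2)"
  define r where "r = (\<lambda>x y. (2 * Q x + Q y) / (Q x + 2 * Q y))"
  define S where "S = supp v"
  have Qpos: "Q x > 0" for x
    using A by (simp add: Q_def add_pos_nonneg)
  have rpos: "r x y > 0" for x y
    using Qpos[of x] Qpos[of y] by (simp add: r_def)
  have rr: "r x y * r y x = 1" for x y
    using Qpos[of x] Qpos[of y] by (simp add: r_def add_pos_pos add_ac)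
  have edge: "2 * (v x * v y) \<le> v x ^ 2 * r x y + v y ^ 2 * r y x" for x y
  proof -
    have "2 * sqrt (r x y) * sqrt (r y x) * (v x * v y) \<le> v x ^ 2 * r x y + v y ^ 2 * r y x"
      using zero_le_power2[of "v x * sqrt (r x y) - v y * sqrt (r y x)"] rpos[of x y] rpos[of y x]
      by (simp add: power2_diff power_mult_distrib algebra_simps)
    moreover have "sqrt (r x y) * sqrt (r y x) = 1"
      using rr[of x y] by (metis real_sqrt_mult real_sqrt_one)
    ultimately show ?thesis by (simp add: mult.assoc)
  qed
  have W: "(\<Sum>e\<in>steps. 1 - r x (x + e)) \<ge> 18 * A / (3 * Q x + 2) ^ 2" for x
  proof -
    define m where "m = norm (real_vec x) ^ 2"
    have m: "m = (\<Sum>k\<in>UNIV. real_of_int (x $ k) ^ 2)"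
      by (simp add: m_def norm_real_vec_sq)
    have Qax: "Q (x + axis k 1) = Q x + 2 * real_of_int (x $ k) + 1"
      "Q (x + axis k (- 1)) = Q x - 2 * real_of_int (x $ k) + 1" for k
      by (simp_all add: Q_def norm_real_vec_add_sq inner_axis_real_vec, simp_all add: real_vec_axis axis_minus)
    have pm: "real_of_int (x $ k) ^ 2 \<le> m" for k
      unfolding m by (rule member_le_sum) auto
    \<comment> \<open>The dimension enters here: for d \<ge> 3 the coefficient 6 d of
      \<open>Q x\<close> is at least 18, so that 18 m is cancelled and 18 A survives.\<close>
    have "18 * A \<le> 2 * real CARD('d) * (3 * Q x + 2) - 18 * m"
    proof -
      have "6 * (3 * Q x + 2) \<le> 2 * real CARD('d) * (3 * Q x + 2)"
        using d Qpos[of x] by (intro mult_right_mono) auto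
      then show ?thesis by (simp add: Q_def m_def)
    qed
    then have "18 * A / (3 * Q x + 2) ^ 2
        \<le> (2 * real CARD('d) * (3 * Q x + 2) - 18 * m) / (3 * Q x + 2) ^ 2"
      by (intro divide_right_mono) auto
    also have "\<dots> = (\<Sum>k\<in>(UNIV :: 'd set). (2 * (3 * Q x + 2) - 18 * real_of_int (x $ k) ^ 2) / (3 * Q x + 2) ^ 2)"
      by (simp add: m sum_subtractf sum_distrib_left flip: sum_divide_distrib)
    also have "\<dots> \<le> (\<Sum>k\<in>UNIV. (1 - r x (x + axis k 1)) + (1 - r x (x + axis k (- 1))))"
    proof (rule sum_mono)
      fix k
      have "A + m = Q x" by (simp add: Q_def m_def)
      then show "(2 * (3 * Q x + 2) - 18 * real_of_int (x $ k) ^ 2) / (3 * Q x + 2) ^ 2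
          \<le> (1 - r x (x + axis k 1)) + (1 - r x (x + axis k (- 1)))"
        using hardy_weight_pair[OF A pm[of k]] by (simp only: r_def Qax)
    qed
    also have "\<dots> = (\<Sum>e\<in>steps. 1 - r x (x + e))"
      by (simp add: sum_steps)
    finally show ?thesis .
  qed
  \<comment> \<open>Reverse every edge. Terms on the left whose far endpoint is outside the support
    vanish, and those gained on the right are nonnegative because \<open>r\<close> is
    positive.\<close>
  have "(\<Sum>x\<in>S. \<Sum>e\<in>steps. v (x + e) ^ 2 * r (x + e) x)
      \<le> (\<Sum>x\<in>S. \<Sum>e\<in>steps. v x ^ 2 * r x (x + e))"
  proof -
    have "(\<Sum>x\<in>S. v (x + e) ^ 2 * r (x + e) x)
        \<le> (\<Sum>x\<in>S. v x ^ 2 * r x (x + - e))" for e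
    proof -
      have "(\<Sum>x\<in>S. v (x + e) ^ 2 * r (x + e) x)
          = (\<Sum>x\<in>{x \<in> S. x + e \<in> S}. v (x + e) ^ 2 * r (x + e) x)"
        using fin by (intro sum.mono_neutral_right) (auto simp: S_def supp_def)
      also have "\<dots> = (\<Sum>x\<in>{x \<in> S. x - e \<in> S}. v x ^ 2 * r x (x + - e))"
        by (rule sum.reindex_bij_witness[of _ "\<lambda>x. x - e" "\<lambda>x. x + e"]) auto
      also have "\<dots> \<le> (\<Sum>x\<in>S. v x ^ 2 * r x (x + - e))"
        using fin rpos by (intro sum_mono2) (auto simp: S_def less_imp_le)
      finally show ?thesis .
    qed
    then have "(\<Sum>e\<in>steps. \<Sum>x\<in>S. v (x + e) ^ 2 * r (x + e) x)
        \<le> (\<Sum>e\<in>steps. \<Sum>x\<in>S. v x ^ 2 * r x (x + - e))"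
      by (rule sum_mono)
    also have "\<dots> = (\<Sum>e\<in>steps. \<Sum>x\<in>S. v x ^ 2 * r x (x + e))"
      by (rule sum_steps_uminus)
    finally show ?thesis
      by (simp only: sum.swap[of _ steps S])
  qed
  moreover have "(\<Sum>x\<in>S. \<Sum>e\<in>steps. 2 * (v x * v (x + e))) \<le>
      (\<Sum>x\<in>S. \<Sum>e\<in>steps. v x ^ 2 * r x (x + e) + v (x + e) ^ 2 * r (x + e) x)"
    by (intro sum_mono edge)
  ultimately have "(\<Sum>x\<in>S. \<Sum>e\<in>steps. v x * v (x + e))
      \<le> (\<Sum>x\<in>S. \<Sum>e\<in>steps. v x ^ 2 * r x (x + e))"
    by (simp add: sum.distrib flip: sum_distrib_left)
  moreover have "dirichlet v = (\<Sum>x\<in>S. \<Sum>e\<in>(steps :: (int ^ 'd) set). v x ^ 2) - (\<Sum>x\<in>S. \<Sum>e\<in>steps. v x * v (x + e))"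
    unfolding dirichlet_def S_def lap_def
    by (simp only: sum_subtractf sum_distrib_left right_diff_distrib power2_eq_square)
  ultimately have "(\<Sum>x\<in>S. \<Sum>e\<in>(steps :: (int ^ 'd) set). v x ^ 2) - (\<Sum>x\<in>S. \<Sum>e\<in>steps. v x ^ 2 * r x (x + e)) \<le> dirichlet v"
    by linarith
  then have "(\<Sum>x\<in>S. v x ^ 2 * (\<Sum>e\<in>steps. 1 - r x (x + e))) \<le> dirichlet v"
    by (simp only: sum_subtractf sum_distrib_left right_diff_distrib mult_1_right)
  moreover have "(\<Sum>x\<in>S. v x ^ 2 * (18 * A / (3 * Q x + 2) ^ 2))
      \<le> (\<Sum>x\<in>S. v x ^ 2 * (\<Sum>e\<in>steps. 1 - r x (x + e)))"
    by (intro sum_mono mult_left_mono W) auto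
  ultimately show ?thesis
    by (simp add: S_def Q_def)
qed

section \<open>Equilibrium potentials\<close>

lemma steps_ne_empty: "(steps :: (int ^ 'd) set) \<noteq> {}"
  by (simp add: steps_eq)

text \<open>At a maximum above \<open>c\<close>, subharmonicity makes all neighbours maximal and
  \<open>bd\<close> keeps them in \<open>D\<close>. Walking on in one fixed direction would give
  infinitely many points above \<open>c\<close>. Finiteness is asked only of the set where
  \<open>f\<close> exceeds \<open>c\<close>, so \<open>D\<close> can be the whole lattice.\<close>

lemma maximum_principle:
  fixes f :: "int ^ 'd \<Rightarrow> real"
  assumes fin: "finite {x \<in> D. f x > c}"
    and sub: "\<And>x. x \<in> D \<Longrightarrow> f x > c \<Longrightarrow> lap f x \<le> 0"
    and bd: "\<And>x e. x \<in> D \<Longrightarrow> f x > c \<Longrightarrow> e \<in> steps \<Longrightarrow> x + e \<notin> D \<Longrightarrow> f (x + e) \<le> c"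
    and x: "x \<in> D"
  shows "f x \<le> c"
proof (rule ccontr)
  assume "\<not> f x \<le> c"
  define A where "A = {x \<in> D. f x > c}"
  have A: "finite A" "A \<noteq> {}"
    using fin x \<open>\<not> f x \<le> c\<close> by (auto simp: A_def)
  define M where "M = Max (f ` A)"
  have M: "f y \<le> M" if "y \<in> A" for y
    using A that by (simp add: M_def)
  obtain x0 where x0: "x0 \<in> A" "f x0 = M"
    using Max_in[of "f ` A"] A unfolding M_def by fastforce
  have "M > c" using x0 by (auto simp: A_def)
  obtain e :: "int ^ 'd" where e: "e \<in> steps"
    using steps_ne_empty by blast
  have step: "y + e \<in> A \<and> f (y + e) = M" if y: "y \<in> A" "f y = M" for y
  proof -
    have le: "f (y + e') \<le> M" if "e' \<in> steps" for e'
    proof (cases "y + e' \<in> A")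
      case False
      then have "f (y + e') \<le> c"
        using y(1) bd[of y e'] that by (force simp: A_def)
      then show ?thesis using \<open>M > c\<close> by simp
    qed (use M in auto)
    have "(\<Sum>e\<in>steps. f y - f (y + e)) \<le> 0"
      using sub[of y] y by (simp add: A_def lap_def)
    moreover have "f y - f (y + e') \<ge> 0" if "e' \<in> steps" for e'
      using le[OF that] y by simp
    ultimately have "(\<Sum>e\<in>steps. f y - f (y + e)) = 0"
      by (meson antisym sum_nonneg)
    then have "f y - f (y + e) = 0"
      using \<open>\<And>e'. e' \<in> steps \<Longrightarrow> f y - f (y + e') \<ge> 0\<close> e
      by (subst (asm) sum_nonneg_eq_0_iff) auto
    then have eq: "f (y + e) = M" using y by simp
    moreover have "y + e \<in> A"
    proof (rule ccontr)
      assume "y + e \<notin> A"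
      then have "f (y + e) \<le> c"
        using y(1) bd[of y e] e by (force simp: A_def)
      then show False using eq \<open>M > c\<close> by simp
    qed
    ultimately show ?thesis by blast
  qed
  define ne :: "nat \<Rightarrow> int ^ 'd" where "ne = (\<lambda>n. \<chi> k. int n * (e $ k))"
  have ne_0: "ne 0 = 0" and ne_Suc: "ne (Suc n) = ne n + e" for n
    by (simp_all add: ne_def vec_eq_iff algebra_simps)
  have walk: "x0 + ne n \<in> A \<and> f (x0 + ne n) = M" for n
  proof (induction n)
    case (Suc n)
    then show ?case
      using step[of "x0 + ne n"] ne_Suc[of n] by (simp add: add.assoc)
  qed (use x0 ne_0 in auto)
  have "inj (\<lambda>n. x0 + ne n)"
  proof (rule injI)
    fix m n
    assume "x0 + ne m = x0 + ne n"
    then have "ne m $ k = ne n $ k" for k by simp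
    then have "int m * (e $ k) = int n * (e $ k)" for k
      by (simp only: ne_def vec_lambda_beta)
    moreover obtain k where "e $ k \<noteq> 0"
      using e by (metis norm_steps norm_zero real_vec_zero vec_eq_iff zero_index zero_neq_one)
    ultimately show "m = n" by (metis mult_cancel_right of_nat_eq_iff)
  qed
  then have "infinite (range (\<lambda>n. x0 + ne n))"
    by (simp add: finite_image_iff)
  moreover have "range (\<lambda>n. x0 + ne n) \<subseteq> A"
    using walk by blast
  ultimately show False
    using A(1) finite_subset by blast
qed

text \<open>Equilibrium potential of the condenser (X, D). The bounds 0 and 1 are part of the
  definition, since the existence proof minimises inside this box.\<close>

definition potential :: "(int ^ 'd) set \<Rightarrow> (int ^ 'd) set \<Rightarrow> (int ^ 'd \<Rightarrow> real) \<Rightarrow> bool" where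
  "potential D X u \<longleftrightarrow> supp u \<subseteq> D \<and> (\<forall>x. 0
      \<le> u x \<and> u x \<le> 1) \<and> (\<forall>x\<in>X. u x = 1) \<and>
     (\<forall>x\<in>D - X. lap u x = 0)"

lemma dirichlet_single:
  fixes x :: "int ^ 'd"
  shows "dirichlet (\<lambda>y. if y = x then t else 0) = 2 * real CARD('d) * t ^ 2"
proof -
  have "x + e \<noteq> x" if "e \<in> steps" for e :: "int ^ 'd"
    using norm_steps[OF that] by auto
  then have "lap (\<lambda>y. if y = x then t else 0) x = 2 * real CARD('d) * t"
    by (simp add: lap_eq card_steps)
  then show ?thesis
    by (subst dirichlet_eq[of "{x}"]) (auto simp: supp_def power2_eq_square)
qed

text \<open>Tychonoff's theorem, with pointwise convergence as the topology on functions.\<close>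

lemma compact_box: "compact {u :: 'a \<Rightarrow> real. \<forall>x. a x \<le> u x \<and> u x \<le> b x}"
proof -
  have "compactin (product_topology (\<lambda>_. euclidean) UNIV) (PiE UNIV (\<lambda>x. {a x..b x}))"
    by (subst compactin_PiE) auto
  then have "compact (PiE UNIV (\<lambda>x. {a x..b x}))"
    by (simp add: euclidean_product_topology)
  moreover have "PiE UNIV (\<lambda>x. {a x..b x}) = {u. \<forall>x. a x \<le> u x \<and> u x \<le> b x}"
    by (auto simp: PiE_def Pi_def)
  ultimately show ?thesis by simp
qed

text \<open>Minimise the Dirichlet form between the indicator functions of \<open>X\<close> and
  \<open>D\<close>. The variation that proves harmonicity moves a value to the mean of its
  neighbours, so the bounds 0 and 1 never obstruct it.\<close>

lemma ex_potential:
  fixes D :: "(int ^ 'd) set"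
  assumes fin: "finite D" and X: "X \<subseteq> D"
  shows "\<exists>u. potential D X u"
proof -
  define S where "S = {u :: int ^ 'd \<Rightarrow> real. \<forall>x. (if x \<in> X then 1 else 0)
      \<le> u x \<and> u x \<le> (if x \<in> D then 1 else 0)}"
  have S_iff: "u \<in> S \<longleftrightarrow> supp u \<subseteq> D \<and> (\<forall>x. 0
      \<le> u x \<and> u x \<le> 1) \<and> (\<forall>x\<in>X. u x = 1)" for u
    using X unfolding S_def supp_subset_iff mem_Collect_eq
    by (smt (verit) subsetD)
  have "continuous_on S (\<lambda>u. \<Sum>x\<in>D. u x * lap u x)"
    unfolding lap_def
    by (intro continuous_intros continuous_on_product_then_coordinatewise continuous_on_id)
  then have cont: "continuous_on S dirichlet"
    by (rule continuous_on_cong[THEN iffD1, rotated 2]) (auto simp: S_iff dirichlet_eq[OF fin])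
  have "(\<lambda>x. if x \<in> X then 1 else 0) \<in> S"
    using X by (auto simp: S_iff supp_subset_iff)
  then have "S \<noteq> {}" by blast
  moreover have "compact S"
    unfolding S_def by (rule compact_box)
  ultimately obtain u where u: "u \<in> S"
      and min: "\<And>v. v \<in> S \<Longrightarrow> dirichlet u \<le> dirichlet v"
    using continuous_attains_inf[OF _ _ cont] by blast
  have "lap u x = 0" if x: "x \<in> D" "x \<notin> X" for x
  proof -
    define q where "q = 2 * real CARD('d)"
    have q: "q > 0" by (simp add: q_def)
    \<comment> \<open>With this choice u x + t is the mean of \<open>u\<close> over the neighbours
      of \<open>x\<close>, hence between 0 and 1.\<close>
    define t where "t = - lap u x / q"
    let ?p = "\<lambda>y. if y = x then t else 0"
    have lt: "q * (u x + t) = (\<Sum>e\<in>steps. u (x + e))"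
      using q by (simp add: t_def lap_eq card_steps q_def field_simps)
    have "(\<Sum>e\<in>steps. u (x + e)) \<le> (\<Sum>e\<in>(steps :: (int ^ 'd) set). 1)"
      using u by (intro sum_mono) (auto simp: S_iff)
    moreover have "0 \<le> (\<Sum>e\<in>steps. u (x + e))"
      using u by (auto simp: S_iff intro!: sum_nonneg)
    ultimately have "0 \<le> q * (u x + t)" "q * (u x + t) \<le> q * 1"
      unfolding lt by (simp_all add: card_steps q_def)
    then have "0 \<le> u x + t" "u x + t \<le> 1"
      using q by (simp_all add: zero_le_mult_iff)
    then have "(\<lambda>y. u y + ?p y) \<in> S"
      using u x by (auto simp: S_iff supp_subset_iff)
    then have "dirichlet u \<le> dirichlet u + 2 * (\<Sum>y\<in>D. ?p y * lap u y) + q * t ^ 2"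
      using min[of "\<lambda>y. u y + ?p y"] u x fin
      by (subst (asm) dirichlet_add[of D]) (auto simp: S_iff supp_subset_iff dirichlet_single q_def)
    also have "(\<Sum>y\<in>D. ?p y * lap u y) = t * lap u x"
      using fin x by (simp add: if_distrib[of "\<lambda>a. a * _"] sum.delta cong: if_cong)
    finally have "0 \<le> 2 * t * lap u x + q * t ^ 2" by simp
    also have "\<dots> = - (lap u x ^ 2) / q"
      using q by (simp add: t_def field_simps power2_eq_square)
    finally have "lap u x ^ 2 \<le> 0"
      using q by (simp add: divide_le_0_iff)
    then show ?thesis by simp
  qed
  then show ?thesis
    using u by (auto simp: potential_def S_iff)
qed

lemma lap_potential_nonneg:
  assumes "potential D X u" "x \<in> X"
  shows "lap u x \<ge> 0"
  unfolding lap_def using assms by (intro sum_nonneg) (auto simp: potential_def)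

lemma lap_potential_le:
  fixes u :: "int ^ 'd \<Rightarrow> real"
  assumes "potential D X u"
  shows "lap u x \<le> 2 * real CARD('d)"
proof -
  have "lap u x \<le> (\<Sum>e\<in>(steps :: (int ^ 'd) set). 1)"
    unfolding lap_def using assms by (intro sum_mono) (smt (verit) potential_def)
  then show ?thesis by (simp add: card_steps)
qed

lemma sum_potential:
  assumes "finite D" "X \<subseteq> D" "potential D X u"
  shows "(\<Sum>x\<in>D. f x * lap u x) = (\<Sum>x\<in>X. f x * lap u x)"
  using assms by (intro sum.mono_neutral_right) (auto simp: potential_def)

lemma dirichlet_potential:
  assumes "finite D" "X \<subseteq> D" "potential D X u"
  shows "dirichlet u = (\<Sum>x\<in>X. lap u x)"
proof -
  have "dirichlet u = (\<Sum>x\<in>X. u x * lap u x)"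
    using assms sum_potential[OF assms, of u] by (simp add: dirichlet_eq potential_def)
  then show ?thesis
    using assms by (simp add: potential_def)
qed

text \<open>For w = v - u the first variation reduces to a sum over \<open>X\<close>, where the
  charge and \<open>w\<close> are both nonnegative; the second variation is a Dirichlet
  form.\<close>

lemma dirichlet_potential_le:
  assumes fin: "finite D" and X: "X \<subseteq> D" and u: "potential D X u"
    and v: "supp v \<subseteq> D" "\<And>x. x \<in> X \<Longrightarrow> v x \<ge> 1"
  shows "dirichlet u \<le> dirichlet v"
proof -
  let ?w = "\<lambda>x. v x - u x"
  have w: "supp ?w \<subseteq> D"
    using u v by (auto simp: potential_def supp_subset_iff)
  have "dirichlet v = dirichlet (\<lambda>x. u x + ?w x)" by simp
  also have "\<dots> = dirichlet u + 2 * (\<Sum>x\<in>D. ?w x * lap u x) + dirichlet ?w"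
    using fin u w by (intro dirichlet_add) (auto simp: potential_def)
  also have "(\<Sum>x\<in>D. ?w x * lap u x) = (\<Sum>x\<in>X. ?w x * lap u x)"
    by (rule sum_potential[OF fin X u])
  finally have "dirichlet v = dirichlet u + 2 * (\<Sum>x\<in>X. ?w x * lap u x) + dirichlet ?w" .
  moreover have "(\<Sum>x\<in>X. ?w x * lap u x) \<ge> 0"
    using lap_potential_nonneg[OF u] u v(2)
      by (intro sum_nonneg mult_nonneg_nonneg) (auto simp: potential_def)
  moreover have "dirichlet ?w \<ge> 0"
    using dirichlet_nonneg finite_subset[OF w fin] by blast
  ultimately show ?thesis by linarith
qed

text \<open>
  Moving one point of \<open>X\<close> from \<open>i\<close> to \<open>j\<close>: raising \<open>u\<close> to \<open>1\<close> at \<open>j\<close> costs only second order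
  because \<open>u\<close> is harmonic there, while lowering \<open>u\<close> at \<open>i\<close> gains \<open>lap u i\<close> to first order.
\<close>

lemma swap_inequality:
  fixes u :: "int ^ 'd \<Rightarrow> real"
  defines "K \<equiv> 4 * real CARD('d)"
  assumes fin: "finite D" and X: "X \<subseteq> D" and u: "potential D X u"
    and i: "i \<in> X" and j: "j \<in> D - X"
    and min: "\<And>v. supp v \<subseteq> D \<Longrightarrow> (\<And>x. x \<in> insert j (X - {i}) \<Longrightarrow> v x \<ge> 1) \<Longrightarrow> dirichlet u - \<eta> \<le> dirichlet v"
  shows "lap u i ^ 2 \<le> K ^ 2 * (1 - u j) ^ 2 + K * \<eta>"
proof -
  have K: "K > 0" by (simp add: K_def)
  \<comment> \<open>Minimises \<open>K * p ^ 2 - 2 * p * lap u i\<close>, the bound for the effect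
    of lowering \<open>u\<close> at \<open>i\<close>; \<open>K\<close> comes from
    \<open>dirichlet_le_sum_sq\<close>. The slack \<open>\<eta>\<close> admits potentials that are
    only nearly optimal.\<close>
  define p where "p = lap u i / K"
  define w where "w = (\<lambda>x. (if x = j then 1 - u j else 0) - (if x = i then p else 0))"
  have ij: "i \<noteq> j" "i \<in> D" using i j X by auto
  have w: "supp w \<subseteq> {i, j}"
    by (auto simp: w_def supp_def)
  then have wD: "supp w \<subseteq> D" using ij j by auto
  have "dirichlet u - \<eta> \<le> dirichlet (\<lambda>x. u x + w x)"
  proof (rule min)
    show "supp (\<lambda>x. u x + w x) \<subseteq> D"
      using u wD by (auto simp: potential_def supp_subset_iff)
  next
    fix x assume "x \<in> insert j (X - {i})"
    then show "u x + w x \<ge> 1"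
      using u j ij by (auto simp: w_def potential_def)
  qed
  also have "\<dots> = dirichlet u + 2 * (\<Sum>x\<in>D. w x * lap u x) + dirichlet w"
    using fin u wD by (intro dirichlet_add) (auto simp: potential_def)
  also have "(\<Sum>x\<in>D. w x * lap u x) = (\<Sum>x\<in>{i, j}. w x * lap u x)"
    using fin w ij j by (intro sum.mono_neutral_right) (auto simp: supp_def)
  also have "\<dots> = - p * lap u i"
    using ij j u by (simp add: w_def potential_def)
  also have "dirichlet w \<le> K * (\<Sum>x\<in>{i, j}. w x ^ 2)"
    unfolding K_def by (rule dirichlet_le_sum_sq) (use w in auto)
  also have "(\<Sum>x\<in>{i, j}. w x ^ 2) = p ^ 2 + (1 - u j) ^ 2"
    using ij by (simp add: w_def)
  finally have "0 \<le> \<eta> - 2 * p * lap u i + K * (p ^ 2 + (1 - u j) ^ 2)" by simp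
  also have "\<dots> = (K * \<eta> - lap u i ^ 2 + K ^ 2 * (1 - u j) ^ 2) / K"
    using K by (simp add: p_def field_simps power2_eq_square)
  finally show ?thesis
    using K by (simp add: zero_le_divide_iff)
qed

section \<open>Edge perimeter and flux\<close>

lemma edge_perimeter_eq: "edge_perimeter X = (\<Sum>i\<in>X. card {e \<in> steps. i + e \<notin> X})"
  unfolding edge_perimeter_def
proof (rule sum.cong)
  fix i :: "int ^ 'a"
  show "card {j. j \<notin> X \<and> adjacent i j} = card {e \<in> steps. i + e \<notin> X}"
    by (rule bij_betw_same_card[of "\<lambda>j. j - i"], rule bij_betw_byWitness[where f'
        = "\<lambda>e. i + e"])
       (auto simp: adjacent_iff_steps)
qed simp

lemma edge_perimeter_le_card:
  fixes X :: "(int ^ 'd) set"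
  shows "edge_perimeter X \<le> 2 * CARD('d) * card X"
proof -
  have "edge_perimeter X \<le> (\<Sum>i\<in>X. card (steps :: (int ^ 'd) set))"
    unfolding edge_perimeter_eq by (intro sum_mono card_mono) auto
  then show ?thesis by (simp add: card_steps mult.commute)
qed

text \<open>Every boundary edge carries a flux of at least \<open>c\<close> out of \<open>X\<close>,
  and no edge at a point of \<open>X\<close> carries a negative one.\<close>

lemma edge_perimeter_le_flux:
  assumes "finite X" "\<And>x. u x \<le> 1" "\<And>x. x \<in> X \<Longrightarrow> u x = 1"
    and c: "\<And>x. x \<notin> X \<Longrightarrow> c \<le> 1 - u x"
  shows "c * real (edge_perimeter X) \<le> (\<Sum>x\<in>X. lap u x)"
proof -
  have "c * real (card {e \<in> steps. x + e \<notin> X}) \<le> lap u x" if x: "x \<in> X" for x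
  proof -
    have "c * real (card {e \<in> steps. x + e \<notin> X})
        = (\<Sum>e\<in>{e \<in> steps. x + e \<notin> X}. c)"
      by simp
    also have "\<dots> \<le> (\<Sum>e\<in>{e \<in> steps. x + e \<notin> X}. u x - u (x + e))"
      using assms x by (intro sum_mono) auto
    also have "\<dots> \<le> lap u x"
      unfolding lap_def using assms x by (intro sum_mono2) auto
    finally show ?thesis .
  qed
  then have "(\<Sum>x\<in>X. c * real (card {e \<in> steps. x + e \<notin> X}))
      \<le> (\<Sum>x\<in>X. lap u x)"
    by (rule sum_mono)
  then show ?thesis
    by (simp add: edge_perimeter_eq sum_distrib_left)
qed

section \<open>Relative capacity\<close>

text \<open>In terms of the length scale \<open>s\<close> the normalising factors are s^(2 - d) for
  energies and s^(1 - d) for perimeters; this form removes the real exponents.\<close>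

lemma side_length:
  assumes "N \<ge> 1"
  defines "s \<equiv> real N powr (1 / real CARD('d::finite))"
  shows "s \<ge> 1" "s ^ CARD('d) = real N"
    "real N powr ((2 - real CARD('d)) / real CARD('d)) = s ^ 2 / real N"
    "real N powr ((1 - real CARD('d)) / real CARD('d)) = s / real N"
proof -
  have N: "real N > 0" using assms by simp
  show "s \<ge> 1"
    unfolding s_def using assms by (intro ge_one_powr_ge_zero) auto
  show "s ^ CARD('d) = real N"
    using N by (simp add: s_def powr_powr flip: powr_realpow)
  have "(2 - real CARD('d)) / real CARD('d) = 1 / real CARD('d) * 2 - 1"
    by (simp add: diff_divide_distrib)
  then show "real N powr ((2 - real CARD('d)) / real CARD('d)) = s ^ 2 / real N"
    using N by (simp only: powr_diff powr_powr[symmetric] s_def[symmetric])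
      (simp add: s_def powr_powr flip: powr_realpow)
  have "(1 - real CARD('d)) / real CARD('d) = 1 / real CARD('d) - 1"
    by (simp add: diff_divide_distrib)
  then show "real N powr ((1 - real CARD('d)) / real CARD('d)) = s / real N"
    using N by (simp only: powr_diff s_def) simp
qed

lemma card_swap:
  assumes "finite X" "i \<in> X" "j \<notin> X"
  shows "card (insert j (X - {i})) = card X"
  using assms by (metis card_Suc_Diff1 card_insert_disjoint finite_Diff Diff_iff)

lemma lattice_ball_eq:
  "(lattice_ball N R :: (int ^ 'd) set) = {x. norm (real_vec x) < R * real N powr (1 / real CARD('d))}"
  by (simp add: lattice_ball_def)

lemma energy_nonneg: "finite (supp u) \<Longrightarrow> energy N u \<ge> 0"
  by (simp add: energy_eq_dirichlet dirichlet_nonneg)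

lemma energy_le_iff:
  fixes u v :: "int ^ 'd \<Rightarrow> real"
  assumes "N \<ge> 1" "finite (supp u)" "finite (supp v)"
  shows "energy N u \<le> energy N v \<longleftrightarrow> dirichlet u \<le> dirichlet v"
  using assms by (simp add: energy_eq_dirichlet)

lemma cap_le:
  assumes "finite (supp v)" "\<And>x. x \<in> X \<Longrightarrow> v x \<ge> 1"
  shows "cap N X \<le> energy N v"
  unfolding cap_def using assms
  by (intro cInf_lower) (auto intro!: bdd_belowI[of _ 0] energy_nonneg)

lemma cap_nonneg:
  assumes "finite X"
  shows "cap N X \<ge> 0"
  unfolding cap_def
proof (rule cInf_greatest)
  have "finite (supp (\<lambda>x. if x \<in> X then 1 else 0))"
    using assms by (rule rev_finite_subset) (auto simp: supp_def)
  then show "{energy N u |u. finite (supp u) \<and> (\<forall>i\<in>X. u i \<ge> 1)} \<noteq> {}"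
    by force
qed (auto intro: energy_nonneg)

lemma rel_cap_le:
  assumes "supp v \<subseteq> lattice_ball N R" "\<And>x. x \<in> X \<Longrightarrow> v x \<ge> 1"
  shows "rel_cap N X R \<le> energy N v"
  unfolding rel_cap_def using assms
  by (intro cInf_lower)
     (auto intro!: bdd_belowI[of _ 0] energy_nonneg intro: finite_subset[OF _ finite_lattice_ball])

lemma rel_cap_potential:
  fixes X :: "(int ^ 'd) set"
  assumes N: "N \<ge> 1" and X: "X \<subseteq> lattice_ball N R"
      and u: "potential (lattice_ball N R) X u"
  shows "rel_cap N X R = energy N u"
proof (rule antisym)
  have su: "supp u \<subseteq> lattice_ball N R" "\<And>x. x \<in> X \<Longrightarrow> u x \<ge> 1"
    using u by (auto simp: potential_def)
  then show "rel_cap N X R \<le> energy N u"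
    by (rule rel_cap_le)
  have fin: "finite (supp v)" if "supp v \<subseteq> lattice_ball N R" for v :: "int ^ 'd \<Rightarrow> real"
    using that finite_subset[OF _ finite_lattice_ball] by blast
  show "energy N u \<le> rel_cap N X R"
    unfolding rel_cap_def
  proof (rule cInf_greatest)
    show "{energy N u |u. supp u \<subseteq> lattice_ball N R \<and> (\<forall>i\<in>X. u i \<ge> 1)} \<noteq> {}"
      using su by blast
  next
    fix a assume "a \<in> {energy N u |u. supp u \<subseteq> lattice_ball N R \<and> (\<forall>i\<in>X. u i \<ge> 1)}"
    then obtain v where v: "a = energy N v" "supp v \<subseteq> lattice_ball N R" "\<forall>i\<in>X. v i \<ge> 1"
      by blast
    then have "dirichlet u \<le> dirichlet v"
      using dirichlet_potential_le[OF finite_lattice_ball X u] by blast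
    then show "energy N u \<le> a"
      using v fin su(1) N by (simp add: energy_le_iff)
  qed
qed

lemma min_cap_le:
  assumes "finite X" "card X = N"
  shows "min_cap TYPE('d::finite) N \<le> cap N (X :: (int ^ 'd) set)"
  unfolding min_cap_def using assms
  by (intro cInf_lower) (auto intro!: bdd_belowI[of _ 0] cap_nonneg)

lemma min_rel_cap_le:
  assumes N: "N \<ge> 1" and X: "X \<subseteq> lattice_ball N R" "card X = N"
  shows "min_rel_cap TYPE('d::finite) N R \<le> rel_cap N (X :: (int ^ 'd) set) R"
  unfolding min_rel_cap_def
proof (rule cInf_lower)
  show "rel_cap N X R \<in> {rel_cap N X R |X :: (int ^ 'd) set. X \<subseteq> lattice_ball N R \<and> finite X \<and> card X = N}"
    using X finite_subset[OF _ finite_lattice_ball] by blast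
  have "0 \<le> rel_cap N Y R" if Y: "Y \<subseteq> lattice_ball N R" for Y :: "(int ^ 'd) set"
  proof -
    obtain u where u: "potential (lattice_ball N R) Y u"
      using ex_potential[OF finite_lattice_ball Y] by blast
    then have "finite (supp u)"
      using finite_subset[OF _ finite_lattice_ball] by (auto simp: potential_def)
    then show ?thesis
      using rel_cap_potential[OF N Y u] energy_nonneg by metis
  qed
  then show "bdd_below {rel_cap N X R |X :: (int ^ 'd) set. X \<subseteq> lattice_ball N R \<and> finite X \<and> card X = N}"
    by (auto intro!: bdd_belowI[of _ 0])
qed

lemma norm_add_step_le:
  assumes "e \<in> steps"
  shows "\<bar>norm (real_vec (x + e)) - norm (real_vec x)\<bar> \<le> 1"
  using norm_triangle_ineq3[of "real_vec (x + e)" "real_vec x"] norm_steps[OF assms]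
  by (simp add: real_vec_add)

text \<open>A cutoff falling linearly over a width of order s has squared differences of order
  s^(-2) at O(s^d) points, and the factor s^(2 - d) turns this into a constant.\<close>

lemma ex_cutoff:
  assumes R: "0 < R'" "R' < R"
  shows "\<exists>C>0. \<forall>N\<ge>1. \<exists>v :: int ^ 'd \<Rightarrow> real. supp v \<subseteq> lattice_ball N R \<and>
    (\<forall>x\<in>lattice_ball N R'. v x \<ge> 1) \<and> energy N v \<le> C"
proof -
  define w where "w = unit_ball_vol (real CARD('d))"
  define C where "C = w * (R + 1 + real CARD('d)) ^ CARD('d) * (2 * real CARD('d)) / (R - R') ^ 2"
  have w: "w > 0" by (simp add: w_def)
  have "C > 0"
    using R w by (auto simp: C_def intro!: mult_pos_pos divide_pos_pos zero_less_power)
  moreover have "\<exists>v :: int ^ 'd \<Rightarrow> real. supp v \<subseteq> lattice_ball N R \<and>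
    (\<forall>x\<in>lattice_ball N R'. v x \<ge> 1) \<and> energy N v
        \<le> C" if N: "N \<ge> 1" for N :: nat
  proof -
    define s where "s = real N powr (1 / real CARD('d))"
    note s = side_length[OF N, where 'd = 'd, folded s_def]
    define L where "L = (R - R') * s"
    have L: "L > 0" using R s(1) by (simp add: L_def)
    define v where "v = (\<lambda>x :: int ^ 'd. max 0 (min 1 ((R * s - norm (real_vec x)) / L)))"
    have ball: "lattice_ball N \<rho> = {x :: int ^ 'd. norm (real_vec x) < \<rho> * s}" for \<rho>
      by (simp add: lattice_ball_eq s_def)
    have supp: "supp v \<subseteq> lattice_ball N R"
    proof
      fix x assume x: "x \<in> supp v"
      show "x \<in> lattice_ball N R"
      proof (rule ccontr)
        assume "x \<notin> lattice_ball N R"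
        then have "(R * s - norm (real_vec x)) / L \<le> 0"
          using L by (intro divide_nonpos_pos) (auto simp: ball)
        then show False using x by (simp add: supp_def v_def)
      qed
    qed
    have fin: "finite (supp v)"
      using supp finite_subset[OF _ finite_lattice_ball] by blast
    have "v x \<ge> 1" if "x \<in> lattice_ball N R'" for x
    proof -
      have "L \<le> R * s - norm (real_vec x)"
        using that by (simp add: ball L_def algebra_simps)
      then have "1 \<le> (R * s - norm (real_vec x)) / L"
        using L by simp
      then show ?thesis by (simp add: v_def)
    qed
    moreover have "energy N v \<le> C"
    proof -
      \<comment> \<open>The extra 1 takes in the neighbours of the support, as
        \<open>two_dirichlet\<close> requires.\<close>
      define A where "A = {x :: int ^ 'd. norm (real_vec x) \<le> R * s + 1}"
      have A: "finite A"
        using finite_bounded_lattice[of "0 :: int ^ 'd" "R * s + 1"] by (simp add: A_def)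
      have "2 * dirichlet v = (\<Sum>x\<in>A. \<Sum>e\<in>steps. (v x - v (x + e)) ^ 2)"
      proof (rule two_dirichlet[OF A])
        show "supp v \<subseteq> A" using supp by (auto simp: ball A_def)
        show "\<forall>x\<in>supp v. \<forall>e\<in>steps. x + e \<in> A"
        proof (intro ballI)
          fix x e :: "int ^ 'd" assume "x \<in> supp v" "e \<in> steps"
          then show "x + e \<in> A"
            using supp norm_add_step_le[of e x] by (auto simp: ball A_def)
        qed
      qed
      also have "\<dots> \<le> (\<Sum>x\<in>A. \<Sum>e\<in>(steps :: (int ^ 'd) set). (1 / L) ^ 2)"
      proof (intro sum_mono)
        fix x e :: "int ^ 'd" assume "e \<in> steps"
        have "\<bar>v x - v (x + e)\<bar>
            \<le> \<bar>(R * s - norm (real_vec x)) / L - (R * s - norm (real_vec (x + e))) / L\<bar>"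
          unfolding v_def by linarith
        also have "\<dots> = \<bar>norm (real_vec (x + e)) - norm (real_vec x)\<bar> / L"
          using L by (simp flip: diff_divide_distrib)
        also have "\<dots> \<le> 1 / L"
          using L norm_add_step_le[OF \<open>e \<in> steps\<close>, of x]
            by (intro divide_right_mono) auto
        finally show "(v x - v (x + e)) ^ 2 \<le> (1 / L) ^ 2"
          by (rule power2_le_iff_abs_le[THEN iffD2, rotated]) (use L in simp)
      qed
      also have "\<dots> = real (card A) * (2 * real CARD('d)) / L ^ 2"
        by (simp add: card_steps power_divide)
      also have "\<dots> \<le> (w * ((R + 1 + real CARD('d)) * s) ^ CARD('d)) * (2 * real CARD('d)) / L ^ 2"
      proof (intro divide_right_mono mult_right_mono)
        have Rs: "R * s \<ge> 0" using R s(1) by simp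
        then have "real (card A) \<le> w * (R * s + 1 + real CARD('d)) ^ CARD('d)"
          using card_le_volume[of "R * s + 1", where 'd = 'd] by (simp add: A_def w_def)
        also have "\<dots> \<le> w * ((R + 1 + real CARD('d)) * s) ^ CARD('d)"
        proof (intro mult_left_mono power_mono)
          show "R * s + 1 + real CARD('d) \<le> (R + 1 + real CARD('d)) * s"
            using mult_left_mono[OF s(1), of "1 + real CARD('d)"] by (simp add: algebra_simps)
        qed (use w Rs in auto)
        finally show "real (card A) \<le> w * ((R + 1 + real CARD('d)) * s) ^ CARD('d)" .
      qed auto
      also have "\<dots> = C * (real N / s ^ 2)"
        using s(1) by (simp add: power_mult_distrib s(2) C_def L_def)
      finally have "2 * dirichlet v \<le> C * (real N / s ^ 2)" .
      then have "s ^ 2 / real N * (2 * dirichlet v) \<le> s ^ 2 / real N * (C * (real N / s ^ 2))"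
        by (intro mult_left_mono) auto
      also have "\<dots> = C"
        using s(1) N by simp
      finally show ?thesis
        using fin by (simp add: energy_eq_dirichlet s(3))
    qed
    ultimately show ?thesis
      using supp by blast
  qed
  ultimately show ?thesis by blast
qed

section \<open>Balls of volume at most N\<close>

lemma power_diff_le:
  fixes a b :: real
  assumes "0 \<le> a" "a \<le> b"
  shows "b ^ Suc n - a ^ Suc n \<le> real (Suc n) * (b - a) * b ^ n"
proof (induction n)
  case (Suc n)
  have "b ^ Suc (Suc n) - a ^ Suc (Suc n) = b * (b ^ Suc n - a ^ Suc n) + (b - a) * a ^ Suc n"
    by (simp add: algebra_simps)
  also have "\<dots> \<le> b * (real (Suc n) * (b - a) * b ^ n) + (b - a) * b ^ Suc n"
    using assms Suc.IH by (intro add_mono mult_left_mono power_mono) auto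
  also have "\<dots> = real (Suc (Suc n)) * (b - a) * b ^ Suc n"
    by (simp add: algebra_simps)
  finally show ?case .
qed simp

text \<open>A boundary edge ends either at a point of the ball missed by \<open>X\<close> or outside
  the ball; in the second case it starts in the outer shell of width 1.\<close>

lemma edge_perimeter_le_complement:
  fixes X :: "(int ^ 'd) set"
  defines "B \<equiv> \<lambda>r. {x :: int ^ 'd. norm (real_vec x) < r}"
  assumes X: "X \<subseteq> B r"
  shows "edge_perimeter X \<le> 2 * CARD('d) * (card (B r - X) + card (B r - B (r - 1)))"
proof -
  have finB: "finite (B r)"
    by (rule finite_subset[OF _ finite_bounded_lattice[of "0 :: int ^ 'd" r]]) (auto simp: B_def)
  let ?P = "(\<lambda>(y, e). (y - e, e)) ` ((B r - X) \<times> steps)"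
  let ?Q = "(B r - B (r - 1)) \<times> (steps :: (int ^ 'd) set)"
  have "finite X" using X finB finite_subset by blast
  then have "edge_perimeter X = card (SIGMA x:X. {e \<in> steps. x + e \<notin> X})"
    by (simp add: edge_perimeter_eq card_SigmaI)
  also have "\<dots> \<le> card (?P \<union> ?Q)"
  proof (intro card_mono subsetI)
    fix p assume "p \<in> (SIGMA x:X. {e \<in> steps. x + e \<notin> X})"
    then obtain x e where p: "p = (x, e)" "x \<in> X" "e \<in> steps" "x + e \<notin> X" by blast
    show "p \<in> ?P \<union> ?Q"
    proof (cases "x + e \<in> B r")
      case True
      then have "p \<in> ?P"
        using p by (intro image_eqI[of _ _ "(x + e, e)"]) auto
      then show ?thesis by blast
    next
      case False
      then show ?thesis
        using p X norm_add_step_le[OF \<open>e \<in> steps\<close>, of x] by (auto simp: B_def)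
    qed
  qed (use finB in auto)
  also have "\<dots> \<le> card ?P + card ?Q"
    by (rule card_Un_le)
  also have "card ?P \<le> card ((B r - X) \<times> (steps :: (int ^ 'd) set))"
    using finB by (intro card_image_le) auto
  finally show ?thesis
    by (simp add: card_cartesian_product card_steps algebra_simps)
qed

lemma scaled_perimeter_le:
  fixes X :: "(int ^ 'd) set"
  assumes N: "N \<ge> 1"
  defines "s \<equiv> real N powr (1 / real CARD('d))"
  shows "real (edge_perimeter X) \<le> b \<Longrightarrow> scaled_perimeter N X \<le> s / real N * b"
  unfolding scaled_perimeter_def side_length[OF N, where 'd = 'd, folded s_def]
  using side_length(1)[OF N, where 'd = 'd, folded s_def] by (intro mult_left_mono) auto

text \<open>
  If the ball has volume at most \<open>N\<close>, then \<open>X\<close> misses only \<open>O(N powr (1 - 1 / d))\<close> of its lattice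
  points, and no minimality is needed.
\<close>

lemma scaled_perimeter_tight_ball:
  assumes R: "R > 0" and vol: "unit_ball_vol (real CARD('d)) * R ^ CARD('d) \<le> 1"
  shows "\<exists>C>0. \<forall>N\<ge>1. \<forall>X :: (int ^ 'd) set. X \<subseteq> lattice_ball N R \<and> card X = N \<longrightarrow> scaled_perimeter N X \<le> C"
proof -
  define d where "d = real CARD('d)"
  define w where "w = unit_ball_vol d"
  have d: "d \<ge> 1" by (simp add: d_def)
  have w: "w > 0" using d by (simp add: w_def)
  obtain n where n: "CARD('d) = Suc n"
    using not0_implies_Suc[of "CARD('d)"] by auto
  define C1 where "C1 = 2 * w * (d * (2 * d + 2) * (R + d + 1) ^ n)"
  define C2 where "C2 = 2 * w * (2 * d + 1) ^ CARD('d)"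
  have C1: "C1 > 0" and C2: "C2 > 0"
    using w d R by (auto simp: C1_def C2_def intro!: mult_pos_pos zero_less_power)
  have "scaled_perimeter N X \<le> 2 * d * (C1 + C2)"
    if N: "N \<ge> 1" and X: "X \<subseteq> lattice_ball N R" "card X = N" for N
        and X :: "(int ^ 'd) set"
  proof -
    define s where "s = real N powr (1 / real CARD('d))"
    note s = side_length[OF N, where 'd = 'd, folded s_def]
    define r where "r = R * s"
    define B where "B = (\<lambda>r. {x :: int ^ 'd. norm (real_vec x) < r})"
    have XB: "X \<subseteq> B r"
      using X by (simp add: lattice_ball_eq B_def r_def s_def)
    have finB: "finite (B r)" for r
      by (rule finite_subset[OF _ finite_bounded_lattice[of "0 :: int ^ 'd" r]]) (auto simp: B_def)
    have BB: "B (r - 1) \<subseteq> B r" by (auto simp: B_def)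
    have r: "r \<ge> 0" using R s(1) by (simp add: r_def)
    have "real (card (B r)) \<le> real (card {x :: int ^ 'd. norm (real_vec x) \<le> r})"
      unfolding B_def using finite_bounded_lattice[of "0 :: int ^ 'd" r]
      by (intro of_nat_mono card_mono) auto
    then have up: "real (card (B r)) \<le> w * (r + d) ^ Suc n"
      using card_le_volume[OF r, where 'd = 'd] by (simp add: w_def d_def n)
    have sn: "s ^ n \<ge> 1" using s(1) by simp
    have Ns: "real N = s * s ^ n"
      using s(2) by (simp add: n)
    have "real (card (B r - X)) + real (card (B r - B (r - 1))) \<le> (C1 + C2) * s ^ n"
    proof -
      have eq: "real (card (B r - X)) + real (card (B r - B (r - 1)))
          = (real (card (B r)) - real N) + (real (card (B r)) - real (card (B (r - 1))))"
        using card_mono[OF finB XB] XB BB X finB finite_subset[OF XB finB] finite_subset[OF BB finB]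
        by (simp add: card_Diff_subset card_mono of_nat_diff)
      show ?thesis
      proof (cases "r - 1 \<ge> d")
        case True
        have "real (card (B (r - 1))) \<ge> w * (r - 1 - d) ^ Suc n"
          using volume_le_card[of "r - 1", where 'd = 'd] True by (simp add: B_def w_def d_def n)
        \<comment> \<open>The volume hypothesis gives w r^d \<le> N. Weakening the radius to r - 1 -
          d lets one difference of powers bound both the missed points and the shell.\<close>
        moreover have "real N \<ge> w * (r - 1 - d) ^ Suc n"
        proof -
          have "w * (r - 1 - d) ^ Suc n \<le> w * r ^ Suc n"
            using w d True by (intro mult_left_mono power_mono) auto
          also have "\<dots> = (w * R ^ CARD('d)) * s ^ CARD('d)"
            by (simp add: r_def power_mult_distrib n mult_ac)
          also have "\<dots> \<le> 1 * s ^ CARD('d)"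
            using vol s(1) by (intro mult_right_mono) (auto simp: w_def d_def)
          finally show ?thesis using s(2) by simp
        qed
        moreover have "w * (r + d) ^ Suc n \<le> w * (r + d + 1) ^ Suc n"
          using w r d by (intro mult_left_mono power_mono) auto
        ultimately have "real (card (B r - X)) + real (card (B r - B (r - 1)))
            \<le> 2 * w * ((r + d + 1) ^ Suc n - (r - 1 - d) ^ Suc n)"
          using eq up by (simp add: right_diff_distrib)
        also have "\<dots> \<le> 2 * w * (real (Suc n) * ((r + d + 1) - (r - 1 - d)) * (r + d + 1) ^ n)"
          using w d True by (intro mult_left_mono power_diff_le) auto
        also have "\<dots> \<le> 2 * w * (real (Suc n) * ((r + d + 1) - (r - 1 - d)) * ((R + d + 1) * s) ^ n)"
        proof (intro mult_left_mono power_mono)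
          show "r + d + 1 \<le> (R + d + 1) * s"
            using mult_left_mono[OF s(1), of "d + 1"] d by (simp add: r_def algebra_simps)
        qed (use w r d in auto)
        also have "\<dots> = C1 * s ^ n"
        proof -
          have "real (Suc n) = d" "(r + d + 1) - (r - 1 - d) = 2 * d + 2"
            by (simp_all add: d_def n)
          then show ?thesis
            by (simp only: C1_def power_mult_distrib mult_ac)
        qed
        also have "\<dots> \<le> (C1 + C2) * s ^ n"
          using C2 sn by (intro mult_right_mono) auto
        finally show ?thesis .
      next
        \<comment> \<open>Now r < d + 1, so the number of points in the ball is bounded
          independently of N.\<close>
        case False
        have "real (card (B r - X)) + real (card (B r - B (r - 1))) \<le> 2 * (w * (r + d) ^ Suc n)"
          using eq up by linarith
        also have "\<dots> \<le> 2 * (w * (2 * d + 1) ^ Suc n)"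
          using w r d False by (intro mult_left_mono power_mono) auto
        also have "\<dots> = C2 * 1"
          by (simp add: C2_def n)
        also have "\<dots> \<le> (C1 + C2) * s ^ n"
          using C1 C2 sn by (intro mult_mono) auto
        finally show ?thesis .
      qed
    qed
    then have "2 * d * real (card (B r - X) + card (B r - B (r - 1))) \<le> 2 * d * ((C1 + C2) * s ^ n)"
      using d by (intro mult_left_mono) auto
    moreover have "real (edge_perimeter X) \<le> 2 * d * real (card (B r - X) + card (B r - B (r - 1)))"
      using of_nat_mono[where 'a = real, OF edge_perimeter_le_complement[OF XB[unfolded B_def]]]
      by (simp add: B_def d_def)
    ultimately have "real (edge_perimeter X) \<le> 2 * d * ((C1 + C2) * s ^ n)"
      by linarith
    then have "scaled_perimeter N X \<le> s / real N * (2 * d * ((C1 + C2) * s ^ n))"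
      unfolding s_def by (rule scaled_perimeter_le[OF N])
    also have "\<dots> = 2 * d * (C1 + C2)"
      using s(1) sn by (simp add: Ns)
    finally show ?thesis .
  qed
  moreover have "2 * d * (C1 + C2) > 0"
    using C1 C2 d by simp
  ultimately show ?thesis by blast
qed

text \<open>Common end of both parts: a flux of O(N / s^2), at least h / s of it through each
  boundary edge, and the factor s / N combine to a bound without \<open>s\<close>.\<close>

lemma scaled_perimeter_le_flux:
  fixes X :: "(int ^ 'd) set"
  assumes N: "N \<ge> 1" and X: "finite X"
    and u: "\<And>x. u x \<le> 1" "\<And>x. x \<in> X \<Longrightarrow> u x = 1"
  defines "s \<equiv> real N powr (1 / real CARD('d))"
  assumes h: "h > 0" "\<And>x. x \<notin> X \<Longrightarrow> h \<le> s * (1 - u x)"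
    and E: "s ^ 2 / real N * (\<Sum>x\<in>X. lap u x) \<le> E"
  shows "scaled_perimeter N X \<le> E / h"
proof -
  note s = side_length[OF N, where 'd = 'd, folded s_def]
  have "h / s * real (edge_perimeter X) \<le> (\<Sum>x\<in>X. lap u x)"
    using X u h s(1) by (intro edge_perimeter_le_flux) (auto simp: field_simps)
  then have "real (edge_perimeter X) \<le> s / h * (\<Sum>x\<in>X. lap u x)"
    using s(1) h(1) by (simp add: field_simps)
  then have "scaled_perimeter N X \<le> s / real N * (s / h * (\<Sum>x\<in>X. lap u x))"
    unfolding s_def by (rule scaled_perimeter_le[OF N])
  also have "\<dots> = (s ^ 2 / real N * (\<Sum>x\<in>X. lap u x)) / h"
    by (simp add: power2_eq_square)
  also have "\<dots> \<le> E / h"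
    using E h(1) by (intro divide_right_mono) auto
  finally show ?thesis .
qed

section \<open>Balls of volume greater than N\<close>

lemma lap_norm_sq: "lap (\<lambda>x :: int ^ 'd. norm (real_vec x) ^ 2) x = - (2 * real CARD('d))"
proof -
  have "lap (\<lambda>x :: int ^ 'd. norm (real_vec x) ^ 2) x =
      (\<Sum>k\<in>(UNIV :: 'd set). - 2)"
    unfolding lap_def sum_steps
    by (rule sum.cong) (simp_all add: norm_real_vec_add_sq inner_axis_real_vec, simp_all add: real_vec_axis axis_minus)
  then show ?thesis by simp
qed

text \<open>
  Outside \<open>X\<close>, \<open>u\<close> lies below the paraboloid \<open>1 + a (\<rho>\<^sup>2 - |x|\<^sup>2)\<close>, which is superharmonic, at least
  \<open>1\<close> on \<open>X\<close> for \<open>\<rho> = max |X|\<close>,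
      and touches \<open>u\<close> at the farthest point of \<open>X\<close>.
\<close>

lemma lap_potential_farthest:
  fixes D X :: "(int ^ 'd) set"
  assumes D: "D = {x. norm (real_vec x) < r}" and r: "r \<ge> 0" and X: "X \<subseteq> D"
      and u: "potential D X u"
    and x: "x \<in> X" "\<And>y. y \<in> X \<Longrightarrow> norm (real_vec y) \<le> norm (real_vec x)"
  shows "lap u x \<ge> (2 * norm (real_vec x) + real CARD('d)) / (r + 1) ^ 2"
proof -
  define \<rho> where "\<rho> = norm (real_vec x)"
  \<comment> \<open>This coefficient keeps \<open>v\<close> nonnegative up to radius r + 1, hence at
    all neighbours of \<open>D\<close>; so \<open>v\<close> dominates \<open>u\<close> also where
    \<open>u\<close> vanishes.\<close>
  define a where "a = 1 / (r + 1) ^ 2"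
  have a: "a > 0" using r by (simp add: a_def)
  define v where "v = (\<lambda>x :: int ^ 'd. 1 + a * (\<rho> ^ 2 - norm (real_vec x) ^ 2))"
  have finD: "finite D"
    unfolding D by (rule finite_subset[OF _ finite_bounded_lattice[of "0 :: int ^ 'd" r]]) auto
  have lapv: "lap v y = 2 * a * real CARD('d)" for y
  proof -
    have "lap v y = (\<Sum>e\<in>steps. - a * (norm (real_vec y) ^ 2 - norm (real_vec (y + e)) ^ 2))"
      by (simp add: lap_def v_def algebra_simps)
    also have "\<dots> = - a * lap (\<lambda>x :: int ^ 'd. norm (real_vec x) ^ 2) y"
      by (simp add: lap_def sum_distrib_left)
    finally show ?thesis by (simp add: lap_norm_sq)
  qed
  have vpos: "v y \<ge> 0" if "norm (real_vec y) \<le> r + 1" for y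
  proof -
    have "a * norm (real_vec y) ^ 2 \<le> a * (r + 1) ^ 2"
      using that a by (intro mult_left_mono power_mono) auto
    also have "\<dots> = 1" using r by (simp add: a_def)
    finally have "a * norm (real_vec y) ^ 2 \<le> 1" .
    moreover have "a * \<rho> ^ 2 \<ge> 0" using a by simp
    ultimately show ?thesis by (simp add: v_def right_diff_distrib)
  qed
  have vX: "v y \<ge> 1" if "y \<in> X" for y
    using x(2)[OF that] a by (simp add: v_def \<rho>_def power_mono)
  have uv: "u y \<le> v y" if y: "norm (real_vec y) \<le> r + 1" for y
  proof (cases "y \<in> D")
    case True
    have "u y - v y \<le> 0"
    proof (rule maximum_principle[of D])
      fix z assume z: "z \<in> D" "0 < u z - v z"
      then have "z \<notin> X"
        using vX[of z] u by (auto simp: potential_def)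
      then show "lap (\<lambda>y. u y - v y) z \<le> 0"
        using z u a by (simp add: lap_diff lapv potential_def)
    next
      fix z e assume z: "z \<in> D" "e \<in> steps" "z + e \<notin> D"
      then have "v (z + e) \<ge> 0"
        using norm_add_step_le[of e z] by (intro vpos) (auto simp: D)
      then show "u (z + e) - v (z + e) \<le> 0"
        using z u by (simp add: potential_def supp_subset_iff)
    qed (use finD True in auto)
    then show ?thesis by simp
  next
    case False
    then show ?thesis
      using vpos[OF y] u by (simp add: potential_def supp_subset_iff)
  qed
  \<comment> \<open>Both functions equal 1 at \<open>x\<close>, so \<open>u\<close> drops at least
    as much as \<open>v\<close>; the maximum with 0 records u \<le> 1.\<close>
  have step: "u x - u (x + e) \<ge> max 0 (a * (2 * (real_vec x \<bullet> real_vec e) + 1))" if "e \<in> steps" for e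
  proof -
    have "norm (real_vec (x + e)) \<le> r + 1"
      using norm_add_step_le[OF that, of x] x(1) X by (auto simp: D)
    then have "u (x + e) \<le> 1 - a * (2 * (real_vec x \<bullet> real_vec e) + 1)"
      using uv[of "x + e"] norm_steps[OF that]
        by (simp add: v_def \<rho>_def norm_real_vec_add_sq algebra_simps inner_commute)
    moreover have "u x = 1" "u (x + e) \<le> 1"
      using u x(1) by (auto simp: potential_def)
    ultimately show ?thesis by simp
  qed
  have "a * (2 * \<rho> + real CARD('d))
      \<le> a * (2 * (\<Sum>k\<in>UNIV. \<bar>real_vec x $ k\<bar>) + real CARD('d))"
    using a norm_le_l1_cart[of "real_vec x"] by (simp add: \<rho>_def)
  also have "\<dots> = (\<Sum>k\<in>(UNIV :: 'd set). a * (2 * \<bar>real_of_int (x $ k)\<bar> + 1))"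
    by (simp add: sum.distrib sum_distrib_left distrib_left mult_ac)
  also have "\<dots> \<le> (\<Sum>k\<in>UNIV. max 0 (a * (2 * (real_vec x \<bullet> real_vec (axis k 1)) + 1)) +
      max 0 (a * (2 * (real_vec x \<bullet> real_vec (axis k (- 1))) + 1)))"
  proof (rule sum_mono)
    fix k
    \<comment> \<open>A step along the axis away from the origin alone supplies the left-hand side;
      the opposite one is merely nonnegative. Over all axes this adds up to the l1 norm, which
      dominates the Euclidean norm.\<close>
    have "a * (2 * \<bar>p\<bar> + 1) \<le> max 0 (a * (2 * p + 1)) + max 0 (a * (2 * (- p) + 1))" for p
      by (cases "p \<ge> 0") (use a in \<open>auto simp: max_def\<close>)
    then show "a * (2 * \<bar>real_of_int (x $ k)\<bar> + 1)
        \<le> max 0 (a * (2 * (real_vec x \<bullet> real_vec (axis k 1)) + 1)) +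
      max 0 (a * (2 * (real_vec x \<bullet> real_vec (axis k (- 1))) + 1))"
      unfolding inner_axis_real_vec by simp
  qed
  also have "\<dots> = (\<Sum>e\<in>steps. max 0 (a * (2 * (real_vec x \<bullet> real_vec e) + 1)))"
    by (rule sum_steps[symmetric])
  also have "\<dots> \<le> lap u x"
    unfolding lap_def using step by (intro sum_mono)
  finally show ?thesis
    by (simp add: a_def \<rho>_def)
qed

lemma unit_volume_radius:
  obtains t where "t > 0" "unit_ball_vol (real CARD('d::finite)) * t ^ CARD('d) = 1"
proof
  define w where "w = unit_ball_vol (real CARD('d))"
  have w: "w > 0" by (simp add: w_def)
  show "root CARD('d) (1 / w) > 0" using w by simp
  show "unit_ball_vol (real CARD('d::finite)) * root CARD('d) (1 / w) ^ CARD('d) = 1"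
    unfolding w_def[symmetric] using w by (subst real_root_pow_pos2) auto
qed

lemma card_lattice_ball_ge:
  assumes N: "N \<ge> 1" and t: "t > 0" "unit_ball_vol (real CARD('d)) * t ^ CARD('d) = 1"
  defines "s \<equiv> real N powr (1 / real CARD('d))"
  assumes R: "t * s \<le> R * s - real CARD('d)"
  shows "N \<le> card (lattice_ball N R :: (int ^ 'd) set)"
proof -
  note s = side_length[OF N, where 'd = 'd, folded s_def]
  define w where "w = unit_ball_vol (real CARD('d))"
  have ts: "t * s > 0" using t s(1) by simp
  have "real N = w * (t * s) ^ CARD('d)"
    using t s(2) by (simp add: power_mult_distrib w_def)
  also have "\<dots> \<le> w * (R * s - real CARD('d)) ^ CARD('d)"
    using R ts by (intro mult_left_mono power_mono) (auto simp: w_def)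
  also have "\<dots> \<le> real (card {x :: int ^ 'd. norm (real_vec x) < R * s})"
    unfolding w_def using R ts by (intro volume_le_card) simp
  finally show ?thesis
    by (simp add: lattice_ball_eq s_def)
qed

text \<open>Here \<open>t * s\<close> is the radius of the ball of volume N. A radius R' strictly
  between t and R leaves room on both sides: below it for N lattice points when s is large, above it
  for a cutoff of bounded energy. For small s the trivial perimeter bound suffices.\<close>

lemma scaled_perimeter_large_ball:
  assumes R: "R > 0" and vol: "unit_ball_vol (real CARD('d)) * R ^ CARD('d) > 1"
  shows "\<exists>C>0. \<forall>N\<ge>1. \<forall>X :: (int ^ 'd) set. X \<subseteq> lattice_ball N R \<and> card X = N \<longrightarrow>
    rel_cap N X R = min_rel_cap TYPE('d) N R \<longrightarrow> scaled_perimeter N X \<le> C"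
proof -
  define d where "d = real CARD('d)"
  define w where "w = unit_ball_vol d"
  have d: "d \<ge> 1" by (simp add: d_def)
  have w: "w > 0" using d by (simp add: w_def)
  obtain t where t: "t > 0" "w * t ^ CARD('d) = 1"
    using unit_volume_radius[where 'd = 'd] unfolding w_def d_def by blast
  have "t < R"
  proof (rule ccontr)
    assume "\<not> t < R"
    then have "w * R ^ CARD('d) \<le> w * t ^ CARD('d)"
      using R w by (intro mult_left_mono power_mono) auto
    then show False using vol t(2) unfolding w_def d_def by linarith
  qed
  define R' where "R' = (t + R) / 2"
  have R': "0 < R'" "t < R'" "R' < R"
    using t \<open>t < R\<close> by (simp_all add: R'_def)
  obtain C0 where C0: "C0 > 0" "\<And>N. N \<ge> 1 \<Longrightarrow> \<exists>v :: int ^ 'd \<Rightarrow> real. supp v \<subseteq> lattice_ball N R \<and>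
      (\<forall>x\<in>lattice_ball N R'. v x \<ge> 1) \<and> energy N v \<le> C0"
    using ex_cutoff[OF R'(1,3), where 'd = 'd] by blast
  \<comment> \<open>From this scale on, the rounding error \<open>d\<close> of the point count fits
    between \<open>t * s\<close> and \<open>R' * s\<close>.\<close>
  define s0 where "s0 = d / (R' - t)"
  \<comment> \<open>The charge t / ((R + 1)^2 s) of the farthest point, divided by the constant 4 d
    of the swap estimate and multiplied by s.\<close>
  define h where "h = t / ((R + 1) ^ 2 * (4 * d))"
  have h: "h > 0" using t R d by (simp add: h_def)
  define C where "C = max (2 * d * s0) (C0 / 2 / h)"
  have "C > 0" using C0(1) h by (simp add: C_def less_max_iff_disj)
  moreover have "scaled_perimeter N X \<le> C"
    if N: "N \<ge> 1" and X: "X \<subseteq> lattice_ball N R" "card X = N"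
      and min: "rel_cap N X R = min_rel_cap TYPE('d) N R" for N and X :: "(int ^ 'd) set"
  proof -
    define s where "s = real N powr (1 / real CARD('d))"
    note s = side_length[OF N, where 'd = 'd, folded s_def]
    let ?D = "lattice_ball N R :: (int ^ 'd) set"
    have ball: "lattice_ball N \<rho> = {x :: int ^ 'd. norm (real_vec x) < \<rho> * s}" for \<rho>
      by (simp add: lattice_ball_eq s_def)
    have finX: "finite X" using X finite_subset[OF _ finite_lattice_ball] by blast
    show ?thesis
    proof (cases "s < s0")
      case True
      have "real (edge_perimeter X) \<le> 2 * d * real N"
        using of_nat_mono[where 'a = real, OF edge_perimeter_le_card[of X]] X(2) by (simp add: d_def)
      then have "scaled_perimeter N X \<le> s / real N * (2 * d * real N)"
        unfolding s_def by (rule scaled_perimeter_le[OF N])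
      also have "\<dots> = 2 * d * s"
        using N by simp
      also have "\<dots> \<le> C"
        using True d unfolding C_def by (intro max.coboundedI1 mult_left_mono) auto
      finally show ?thesis .
    next
      case False
      then have "d \<le> s * (R' - t)"
        using R' by (simp add: s0_def field_simps)
      then have s0: "t * s \<le> R' * s - d" by (simp add: algebra_simps)
      have ts: "t * s > 0" using t s(1) by simp
      have "N \<le> card (lattice_ball N R' :: (int ^ 'd) set)"
        using t s0 ts unfolding s_def d_def w_def by (intro card_lattice_ball_ge[OF N, of t]) auto
      then obtain X0 :: "(int ^ 'd) set" where X0: "X0 \<subseteq> lattice_ball N R'" "card X0 = N"
        by (meson obtain_subset_with_card_n)
      obtain v :: "int ^ 'd \<Rightarrow> real" where v: "supp v \<subseteq> lattice_ball N R"
          "\<forall>x\<in>lattice_ball N R'. v x \<ge> 1" "energy N v \<le> C0"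
        using C0(2)[OF N] by blast
      have "X0 \<subseteq> lattice_ball N R"
      proof -
        have "lattice_ball N R' \<subseteq> ?D"
          using R'(3) s(1) by (auto simp: ball intro: order_less_le_trans mult_right_mono)
        then show ?thesis using X0 by blast
      qed
      then have "min_rel_cap TYPE('d) N R \<le> rel_cap N X0 R"
        using X0 by (intro min_rel_cap_le[OF N]) auto
      also have "\<dots> \<le> energy N v"
        using v X0 by (intro rel_cap_le) auto
      finally have mC: "min_rel_cap TYPE('d) N R \<le> C0" using v(3) by simp
      obtain u where u: "potential ?D X u"
        using ex_potential[OF finite_lattice_ball X(1)] by blast
      have u1: "u x \<le> 1" "x \<in> X \<Longrightarrow> u x = 1" for x
        using u by (auto simp: potential_def)
      have finu: "finite (supp u)"
        using u finite_subset[OF _ finite_lattice_ball] by (auto simp: potential_def)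
      have Eu: "energy N u = min_rel_cap TYPE('d) N R"
        using rel_cap_potential[OF N X(1) u] min by simp
      obtain x where x: "x \<in> X" "\<And>y. y \<in> X \<Longrightarrow> norm (real_vec y)
          \<le> norm (real_vec x)"
      proof -
        have "X \<noteq> {}" using X N by auto
        then have "Max ((\<lambda>y. norm (real_vec y)) ` X) \<in> (\<lambda>y. norm (real_vec y)) ` X"
          using finX by (intro Max_in) auto
        then obtain x where "x \<in> X" "norm (real_vec x) = Max ((\<lambda>y. norm (real_vec y)) ` X)"
          by auto
        then show ?thesis
          using finX by (intro that[of x]) auto
      qed
      have lapx: "lap u x \<ge> t / ((R + 1) ^ 2 * s)"
      proof -
        define \<rho> where "\<rho> = norm (real_vec x)"
        \<comment> \<open>Otherwise the closed ball of radius \<open>\<rho>\<close>, which contains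
          \<open>X\<close>, would have fewer than N lattice points.\<close>
        have "t * s \<le> \<rho> + d"
        proof (rule ccontr)
          assume "\<not> t * s \<le> \<rho> + d"
          then have "w * (\<rho> + d) ^ CARD('d) < w * (t * s) ^ CARD('d)"
            using w d by (intro mult_strict_left_mono power_strict_mono) (auto simp: \<rho>_def)
          also have "\<dots> = real N"
            using t s(2) by (simp add: power_mult_distrib)
          also have "real N \<le> real (card {x :: int ^ 'd. norm (real_vec x) \<le> \<rho>})"
            unfolding X(2)[symmetric] using x finite_bounded_lattice[of "0 :: int ^ 'd" \<rho>]
            by (intro of_nat_mono card_mono) (auto simp: \<rho>_def)
          also have "\<dots> \<le> w * (\<rho> + d) ^ CARD('d)"
            using card_le_volume[of \<rho>, where 'd = 'd] by (simp add: \<rho>_def w_def d_def)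
          finally show False by simp
        qed
        moreover have "\<rho> \<ge> 0" by (simp add: \<rho>_def)
        ultimately have "t * s \<le> 2 * \<rho> + d" by linarith
        moreover have "R * s + 1 > 0"
          using R s(1) by (intro add_nonneg_pos) auto
        moreover have "(R * s + 1) ^ 2 \<le> ((R + 1) * s) ^ 2"
          using R s(1) by (intro power_mono) (auto simp: algebra_simps)
        ultimately have "t * s / ((R + 1) * s) ^ 2 \<le> (2 * \<rho> + d) / (R * s + 1) ^ 2"
          using ts by (intro frac_le) auto
        also have "\<dots> \<le> lap u x"
          unfolding \<rho>_def d_def using R s(1) X(1) u x
          by (intro lap_potential_farthest[of ?D]) (auto simp: ball)
        finally show ?thesis
          using s(1) by (simp add: power_mult_distrib power2_eq_square)
      qed
      have "h \<le> s * (1 - u j)" if j: "j \<notin> X" for j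
      proof -
        have "lap u x \<le> 4 * d * (1 - u j)"
        proof (cases "j \<in> ?D")
          \<comment> \<open>A point outside the ball is not an admissible replacement for
            \<open>x\<close>, but there the jump is 1 and the trivial bound on charges
            suffices.\<close>
          case False
          then have "u j = 0" using u by (auto simp: potential_def supp_def)
          then show ?thesis
            using lap_potential_le[OF u, of x] d by (simp add: d_def)
        next
          case True
          \<comment> \<open>The slack is 0 because the potential attains the relative
            capacity.\<close>
          have "lap u x ^ 2 \<le> (4 * real CARD('d)) ^ 2 * (1 - u j) ^ 2 + 4 * real CARD('d) * 0"
          proof (rule swap_inequality[OF finite_lattice_ball X(1) u x(1)])
            show "j \<in> ?D - X" using True j by simp
            fix v :: "int ^ 'd \<Rightarrow> real"
            assume v: "supp v \<subseteq> ?D" "\<And>y. y \<in> insert j (X - {x}) \<Longrightarrow> v y \<ge> 1"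
            have "min_rel_cap TYPE('d) N R \<le> rel_cap N (insert j (X - {x})) R"
              using True X card_swap[OF finX x(1) j] by (intro min_rel_cap_le[OF N]) auto
            also have "\<dots> \<le> energy N v"
              using v by (intro rel_cap_le) auto
            finally have "energy N u \<le> energy N v" by (simp add: Eu)
            then show "dirichlet u - 0 \<le> dirichlet v"
              using energy_le_iff[OF N finu finite_subset[OF v(1) finite_lattice_ball]] by simp
          qed
          then have "lap u x ^ 2 \<le> (4 * d * (1 - u j)) ^ 2"
            by (simp add: d_def power_mult_distrib)
          then show ?thesis
            by (rule power2_le_imp_le) (use d u1 in auto)
        qed
        then have "t / ((R + 1) ^ 2 * s) \<le> 4 * d * (1 - u j)"
          using lapx by linarith
        then show ?thesis
          using s(1) d R by (simp add: h_def field_simps)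
      qed
      moreover have "s ^ 2 / real N * (\<Sum>x\<in>X. lap u x) \<le> C0 / 2"
        using mC Eu finu dirichlet_potential[OF finite_lattice_ball X(1) u]
        by (simp add: energy_eq_dirichlet s(3) mult_ac)
      ultimately have "scaled_perimeter N X \<le> C0 / 2 / h"
        using finX u1 h unfolding s_def by (intro scaled_perimeter_le_flux[OF N]) auto
      then show ?thesis by (simp add: C_def)
    qed
  qed
  ultimately show ?thesis by blast
qed

section \<open>Capacity in the whole space\<close>

text \<open>Adjoining \<open>X\<close> makes every member, from n = 0 on, an admissible domain for
  \<open>X\<close>.\<close>

definition exhaustion :: "(int ^ 'd) set \<Rightarrow> nat \<Rightarrow> (int ^ 'd) set" where
  "exhaustion X n = X \<union> {x. norm (real_vec x) \<le> real n}"

lemma finite_exhaustion: "finite X \<Longrightarrow> finite (exhaustion X n)"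
  using finite_bounded_lattice[of 0 "real n"] by (simp add: exhaustion_def)

lemma subset_exhaustion: "X \<subseteq> exhaustion X n"
  by (simp add: exhaustion_def)

lemma eventually_subset_exhaustion:
  fixes F X :: "(int ^ 'd) set"
  assumes "finite F"
  shows "eventually (\<lambda>n. F \<subseteq> exhaustion X n) sequentially"
proof -
  have "eventually (\<lambda>n. \<forall>x\<in>F. x \<in> exhaustion X n) sequentially"
  proof (rule eventually_ball_finite[OF assms], rule ballI)
    fix x :: "int ^ 'd"
    have "eventually (\<lambda>n. norm (real_vec x) \<le> real n) sequentially"
      using filterlim_real_sequentially by (simp add: filterlim_at_top)
    then show "eventually (\<lambda>n. x \<in> exhaustion X n) sequentially"
      by eventually_elim (simp add: exhaustion_def)
  qed
  then show ?thesis by (simp add: subset_iff Ball_def)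
qed

text \<open>Yields pointwise convergence along the exhaustion. Off \<open>D\<close> the function
  \<open>u\<close> vanishes and on \<open>X\<close> both are 1, so u - v can be positive only where
  it is harmonic.\<close>

lemma potential_mono:
  assumes fin: "finite D" and D: "D \<subseteq> D'" and u: "potential D X u" and v: "potential D' X v"
  shows "u x \<le> v x"
proof (cases "x \<in> D")
  case True
  have "u x - v x \<le> 0"
  proof (rule maximum_principle[of D])
    fix z assume z: "z \<in> D" "0 < u z - v z"
    then have "z \<notin> X"
      using u v by (auto simp: potential_def)
    then show "lap (\<lambda>y. u y - v y) z \<le> 0"
      using z u v D by (auto simp: lap_diff potential_def)
  next
    fix z e assume "z + e \<notin> D"
    then show "u (z + e) - v (z + e) \<le> 0"
      using u v by (simp add: potential_def supp_subset_iff)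
  qed (use fin True in auto)
  then show ?thesis by simp
qed (use u v in \<open>simp add: potential_def supp_subset_iff\<close>)

text \<open>
  The infimum defining \<open>cap\<close> is not attained
    by finitely supported functions.  The minimiser is
  replaced by the increasing limit of the potentials of \<open>X\<close> relative to an exhaustion.
\<close>

definition limit_potential :: "(int ^ 'd) set \<Rightarrow> (nat \<Rightarrow> int ^ 'd \<Rightarrow> real) \<Rightarrow> (int ^ 'd \<Rightarrow> real) \<Rightarrow> bool" where
  "limit_potential X U u \<longleftrightarrow>
     (\<forall>n. potential (exhaustion X n) X (U n)) \<and> (\<forall>x. (\<lambda>n. U n x) \<longlonglongrightarrow> u x)"

lemma ex_limit_potential:
  fixes X :: "(int ^ 'd) set"
  assumes "finite X"
  shows "\<exists>U u. limit_potential X U u"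
proof -
  have "\<forall>n. \<exists>u. potential (exhaustion X n) X u"
    using ex_potential[OF finite_exhaustion[OF assms] subset_exhaustion] by blast
  then obtain U where U: "\<And>n. potential (exhaustion X n) X (U n)"
    by metis
  have "\<exists>l. (\<lambda>n. U n x) \<longlonglongrightarrow> l" for x
  proof -
    have "incseq (\<lambda>n. U n x)"
    proof (rule incseq_SucI)
      fix n
      show "U n x \<le> U (Suc n) x"
        by (rule potential_mono[OF finite_exhaustion[OF assms] _ U U]) (auto simp: exhaustion_def)
    qed
    moreover have "\<forall>n. U n x \<le> 1"
      using U by (auto simp: potential_def)
    ultimately show ?thesis
      by (rule incseq_convergent) blast
  qed
  then obtain u where "\<And>x. (\<lambda>n. U n x) \<longlonglongrightarrow> u x"
    by metis
  with U show ?thesis by (auto simp: limit_potential_def)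
qed

context
  fixes X :: "(int ^ 'd) set" and U u
  assumes fin: "finite X" and lim: "limit_potential X U u"
begin

lemma limit_potential_approx:
  "potential (exhaustion X n) X (U n)" "(\<lambda>n. U n x) \<longlonglongrightarrow> u x"
  using lim by (auto simp: limit_potential_def)

lemma limit_potential_range: "0 \<le> u x" "u x \<le> 1"
proof -
  show "0 \<le> u x"
    by (rule LIMSEQ_le_const[OF limit_potential_approx(2)])
       (use limit_potential_approx(1) in \<open>auto simp: potential_def\<close>)
  show "u x \<le> 1"
    by (rule LIMSEQ_le_const2[OF limit_potential_approx(2)])
       (use limit_potential_approx(1) in \<open>auto simp: potential_def\<close>)
qed

lemma limit_potential_eq_1:
  assumes "x \<in> X"
  shows "u x = 1"
proof -
  have "(\<lambda>n. U n x) = (\<lambda>n. 1)"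
    using assms limit_potential_approx(1) by (auto simp: potential_def)
  then show ?thesis
    using limit_potential_approx(2)[of x] LIMSEQ_unique[OF tendsto_const] by metis
qed

lemma tendsto_lap_limit_potential: "(\<lambda>n. lap (U n) x) \<longlonglongrightarrow> lap u x"
  unfolding lap_def by (intro tendsto_intros limit_potential_approx)

lemma lap_limit_potential:
  assumes "x \<notin> X"
  shows "lap u x = 0"
proof -
  have "eventually (\<lambda>n. {x} \<subseteq> exhaustion X n) sequentially"
    by (rule eventually_subset_exhaustion) simp
  then have "eventually (\<lambda>n. lap (U n) x = 0) sequentially"
    by eventually_elim (use assms limit_potential_approx(1) in \<open>auto simp: potential_def\<close>)
  then have "(\<lambda>n. lap (U n) x) \<longlonglongrightarrow> 0"
    by (rule tendsto_eventually)
  then show ?thesis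
    using LIMSEQ_unique tendsto_lap_limit_potential by blast
qed

lemma finite_supp_approx: "finite (supp (U n))"
  using limit_potential_approx(1)[of n] finite_exhaustion[OF fin] finite_subset
  by (auto simp: potential_def)

lemma dirichlet_approx: "dirichlet (U n) = (\<Sum>x\<in>X. lap (U n) x)"
  by (rule dirichlet_potential[OF finite_exhaustion[OF fin] subset_exhaustion limit_potential_approx(1)])

lemma tendsto_dirichlet_approx: "(\<lambda>n. dirichlet (U n)) \<longlonglongrightarrow> (\<Sum>x\<in>X. lap u x)"
  unfolding dirichlet_approx by (intro tendsto_sum tendsto_lap_limit_potential)

text \<open>The support of any admissible competitor is eventually contained in the exhaustion, and
  from then on \<open>U n\<close> has no more energy than it.\<close>

lemma tendsto_energy_approx:
  assumes N: "N \<ge> 1"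
  shows "(\<lambda>n. energy N (U n)) \<longlonglongrightarrow> cap N X"
proof (rule order_tendstoI)
  fix a assume a: "a < cap N X"
  have "cap N X \<le> energy N (U n)" for n
    using limit_potential_approx(1)[of n] finite_supp_approx by (intro cap_le) (auto simp: potential_def)
  then show "eventually (\<lambda>n. a < energy N (U n)) sequentially"
    using a by (intro always_eventually allI) (rule order_less_le_trans)
next
  fix a assume "cap N X < a"
  have "{energy N u |u. finite (supp u) \<and> (\<forall>i\<in>X. u i \<ge> 1)} \<noteq> {}"
    using finite_supp_approx[of 0] limit_potential_approx(1)[of 0] by (force simp: potential_def)
  then obtain v where v: "finite (supp v)" "\<forall>i\<in>X. v i \<ge> 1" "energy N v < a"
    using \<open>cap N X < a\<close> unfolding cap_def
      by (subst (asm) cInf_less_iff) (auto intro!: bdd_belowI[of _ 0] energy_nonneg)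
  have "eventually (\<lambda>n. supp v \<subseteq> exhaustion X n) sequentially"
    using v(1) by (rule eventually_subset_exhaustion)
  then show "eventually (\<lambda>n. energy N (U n) < a) sequentially"
  proof eventually_elim
    case (elim n)
    have "dirichlet (U n) \<le> dirichlet v"
      using v(2) elim
      by (intro dirichlet_potential_le[OF finite_exhaustion[OF fin] subset_exhaustion limit_potential_approx(1)]) auto
    then show ?case
      using v N energy_le_iff[OF N finite_supp_approx v(1), of n] by linarith
  qed
qed

text \<open>The flux involves only the finitely many points of \<open>X\<close>, so it passes to the
  limit without touching the energy of \<open>u\<close>, an infinite sum.\<close>

lemma cap_eq_flux:
  assumes N: "N \<ge> 1"
  shows "cap N X = real N powr ((2 - real CARD('d)) / real CARD('d)) * (2 * (\<Sum>x\<in>X. lap u x))"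
proof (rule LIMSEQ_unique[OF tendsto_energy_approx[OF N]])
  show "(\<lambda>n. energy N (U n)) \<longlonglongrightarrow>
      real N powr ((2 - real CARD('d)) / real CARD('d)) * (2 * (\<Sum>x\<in>X. lap u x))"
    unfolding energy_eq_dirichlet[OF finite_supp_approx]
      by (intro tendsto_intros tendsto_dirichlet_approx)
qed

text \<open>Replaces decay at infinity in the maximum principle. The Dirichlet forms of the
  \<open>U n\<close> are bounded by the trivial bound on charges, so on a finite set the squared
  differences of \<open>u\<close> have a bound independent of the set.\<close>

lemma finite_steep_edges:
  assumes e: "e \<in> steps" and H: "H > 0"
  shows "finite {x. u (x + e) - u x > H}"
proof (rule ccontr)
  define C where "C = 2 * (real (card X) * (2 * real CARD('d)))"
  assume "infinite {x. u (x + e) - u x > H}"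
  then obtain F where F: "F \<subseteq> {x. u (x + e) - u x > H}" "finite F" "card F
      = nat \<lceil>C / H ^ 2\<rceil> + 1"
    using infinite_arbitrarily_large by blast
  have "(\<Sum>x\<in>F. (U n x - U n (x + e)) ^ 2) \<le> C" for n
  proof -
    have "(\<Sum>x\<in>F. (U n x - U n (x + e)) ^ 2)
        \<le> (\<Sum>x\<in>F. \<Sum>e\<in>steps. (U n x - U n (x + e)) ^ 2)"
      using e by (intro sum_mono member_le_sum) auto
    also have "\<dots> \<le> 2 * dirichlet (U n)"
      by (rule sum_gradient_le_dirichlet[OF finite_supp_approx F(2)])
    also have "dirichlet (U n) \<le> (\<Sum>x\<in>X. 2 * real CARD('d))"
      unfolding dirichlet_approx by (intro sum_mono lap_potential_le[OF limit_potential_approx(1)])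
    finally show ?thesis by (simp add: C_def)
  qed
  moreover have "(\<lambda>n. \<Sum>x\<in>F. (U n x - U n (x + e)) ^ 2) \<longlonglongrightarrow> (\<Sum>x\<in>F. (u x - u (x + e)) ^ 2)"
    by (intro tendsto_intros limit_potential_approx)
  ultimately have "(\<Sum>x\<in>F. (u x - u (x + e)) ^ 2) \<le> C"
    by (intro LIMSEQ_le_const2) auto
  moreover have "(\<Sum>x\<in>F. H ^ 2) \<le> (\<Sum>x\<in>F. (u x - u (x + e)) ^ 2)"
  proof (rule sum_mono)
    fix x assume "x \<in> F"
    then have "H \<le> u (x + e) - u x" using F by auto
    then have "H ^ 2 \<le> (u (x + e) - u x) ^ 2" using H by (intro power_mono) auto
    then show "H ^ 2 \<le> (u x - u (x + e)) ^ 2" by (simp add: power2_commute)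
  qed
  ultimately have "real (card F) \<le> C / H ^ 2"
    using H by (simp add: field_simps)
  then show False
    using F(3) by linarith
qed

text \<open>The difference is harmonic unless one endpoint is in \<open>X\<close>. If
  \<open>x\<close> is, the difference is at most 0; if x + e is, it is one of the nonnegative terms
  of a charge, hence at most \<open>H\<close>.\<close>

lemma limit_potential_lipschitz:
  assumes H: "H > 0" "\<And>x. x \<in> X \<Longrightarrow> lap u x \<le> H" and e: "e \<in> steps"
  shows "u (x + e) - u x \<le> H"
proof (rule maximum_principle[of UNIV])
  show "finite {x \<in> UNIV. H < u (x + e) - u x}"
    using finite_steep_edges[OF e H(1)] by simp
  fix x assume x: "H < u (x + e) - u x"
  have "x \<notin> X"
    using x H limit_potential_range(2)[of "x + e"] limit_potential_eq_1[of x] by auto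
  moreover have "x + e \<notin> X"
  proof
    assume xe: "x + e \<in> X"
    have "u (x + e) - u ((x + e) + (- e)) \<le> lap u (x + e)"
      unfolding lap_def using e limit_potential_eq_1[OF xe] limit_potential_range(2)
      by (intro member_le_sum[of "- e" steps "\<lambda>e'. u (x + e) - u (x + e + e')"]) auto
    then show False
      using x H(2)[OF xe] by simp
  qed
  moreover have "lap (\<lambda>x. u (x + e)) x = lap u (x + e)"
    by (rule lap_shift)
  ultimately show "lap (\<lambda>x. u (x + e) - u x) x \<le> 0"
    by (simp add: lap_diff lap_limit_potential)
qed auto

end

section \<open>Lower bound for the largest charge\<close>

lemma l1_lipschitz:
  fixes u :: "int ^ 'd \<Rightarrow> real"
  assumes "\<And>x e. e \<in> steps \<Longrightarrow> u (x + e) - u x \<le> H"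
  shows "u x - u (x + y) \<le> H * real_of_int (\<Sum>k\<in>UNIV. \<bar>y $ k\<bar>)"
proof (induction "nat (\<Sum>k\<in>UNIV. \<bar>y $ k\<bar>)" arbitrary: y)
  case 0
  then have "(\<Sum>k\<in>UNIV. \<bar>y $ k\<bar>) \<le> 0"
    by simp
  then have "(\<Sum>k\<in>UNIV. \<bar>y $ k\<bar>) = 0"
    by (intro antisym sum_nonneg) auto
  moreover from this have "y = 0"
    by (subst (asm) sum_nonneg_eq_0_iff) (auto simp: vec_eq_iff)
  ultimately show ?case by simp
next
  case (Suc n)
  then obtain k where k: "y $ k \<noteq> 0"
    by (metis (no_types, lifting) abs_zero nat_0 sum.neutral nat.distinct(1))
  define e :: "int ^ 'd" where "e = axis k (sgn (y $ k))"
  have e: "e \<in> steps"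
    using k by (auto simp: e_def steps_eq sgn_if)
  have "(\<Sum>l\<in>UNIV - {k}. \<bar>(y - e) $ l\<bar>) = (\<Sum>l\<in>UNIV - {k}. \<bar>y $ l\<bar>)"
    by (rule sum.cong) (auto simp: e_def axis_def)
  moreover have "\<bar>(y - e) $ k\<bar> = \<bar>y $ k\<bar> - 1"
    using k by (auto simp: e_def axis_def sgn_if)
  ultimately have *: "(\<Sum>l\<in>UNIV. \<bar>(y - e) $ l\<bar>)
      = (\<Sum>l\<in>UNIV. \<bar>y $ l\<bar>) - 1"
    by (simp add: sum.remove[of UNIV k])
  then have "n = nat (\<Sum>l\<in>UNIV. \<bar>(y - e) $ l\<bar>)"
    using Suc.hyps(2) by simp
  then have "u x - u (x + (y - e)) \<le> H * real_of_int (\<Sum>l\<in>UNIV. \<bar>(y - e) $ l\<bar>)"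
    by (rule Suc.hyps(1))
  moreover have "u (x + (y - e)) - u (x + y) \<le> H"
    using assms[of "- e" "x + y"] e by (simp add: algebra_simps)
  ultimately show ?case
    unfolding * by (simp add: algebra_simps)
qed

lemma dirichlet_shift:
  fixes u :: "int ^ 'd \<Rightarrow> real"
  shows "dirichlet (\<lambda>x. u (x + a)) = dirichlet u"
  unfolding dirichlet_def lap_shift
  by (rule sum.reindex_bij_witness[of _ "\<lambda>x. x - a" "\<lambda>x. x + a"]) (auto simp: supp_def)

text \<open>Choosing A = r^2 makes the Hardy weight of order r^(-2) throughout the ball;
  \<open>r \<ge> 2\<close> is the requirement \<open>A \<ge> 4\<close>.\<close>

lemma sum_sq_le_dirichlet:
  fixes v :: "int ^ 'd \<Rightarrow> real"
  assumes d: "CARD('d) \<ge> 3" and r: "r \<ge> 2" and fin: "finite (supp v)"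
  shows "(\<Sum>x\<in>{x. norm (real_vec x) \<le> r}. v x ^ 2) \<le> 3 * r ^ 2 * dirichlet v"
proof -
  define A where "A = r ^ 2"
  have A: "A \<ge> 4"
    using power_mono[OF r, of 2] by (simp add: A_def)
  define W where "W = (\<lambda>x :: int ^ 'd. 18 * A / (3 * (A + norm (real_vec x) ^ 2) + 2) ^ 2)"
  have W0: "W x \<ge> 0" for x using A by (simp add: W_def)
  let ?F = "{x :: int ^ 'd. norm (real_vec x) \<le> r}"
  have finF: "finite ?F"
    using finite_bounded_lattice[of "0 :: int ^ 'd" r] by simp
  have W: "1 / (3 * A) \<le> W x" if "x \<in> ?F" for x
  proof -
    define m where "m = norm (real_vec x) ^ 2"
    have "m \<le> A"
      unfolding m_def A_def using that by (intro power_mono) auto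
    moreover have "m \<ge> 0" by (simp add: m_def)
    ultimately have le: "3 * (A + m) + 2 \<le> 7 * A" and pos: "3 * (A + m) + 2 > 0"
      using A by simp_all
    then have "(3 * (A + m) + 2) ^ 2 \<le> (7 * A) ^ 2"
      by (intro power_mono) auto
    then have "18 * A / (7 * A) ^ 2 \<le> 18 * A / (3 * (A + m) + 2) ^ 2"
      using A pos by (intro divide_left_mono) auto
    moreover have "1 / (3 * A) \<le> 18 * A / (7 * A) ^ 2"
      using A by (simp add: field_simps power2_eq_square)
    ultimately show ?thesis by (simp add: W_def m_def)
  qed
  have "(\<Sum>x\<in>?F. v x ^ 2 * (1 / (3 * A))) \<le> (\<Sum>x\<in>?F. v x ^ 2 * W x)"
    using W by (intro sum_mono mult_left_mono) auto
  also have "\<dots> = (\<Sum>x\<in>?F \<inter> supp v. v x ^ 2 * W x)"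
    using finF by (intro sum.mono_neutral_right) (auto simp: supp_def)
  also have "\<dots> \<le> (\<Sum>x\<in>supp v. v x ^ 2 * W x)"
    using fin W0 by (intro sum_mono2) auto
  also have "\<dots> \<le> dirichlet v"
    unfolding W_def by (rule hardy[OF d A fin])
  finally have "(\<Sum>x\<in>?F. v x ^ 2) / (3 * A) \<le> dirichlet v"
    by (simp flip: sum_divide_distrib)
  then have "(\<Sum>x\<in>?F. v x ^ 2) \<le> dirichlet v * (3 * A)"
    using A by (simp add: pos_divide_le_eq)
  then show ?thesis
    by (simp add: A_def mult_ac)
qed

text \<open>
  If every jump across the boundary of \<open>X\<close> were small, the gradient bound would force
  \<open>u \<ge> 1 / 2\<close> on a ball too large for the capacity of \<open>X\<close>.
\<close>

lemma ex_large_flux: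
  fixes C0 :: real
  assumes d3: "CARD('d) \<ge> 3" and C0: "C0 > 0"
  shows "\<exists>c>0. \<forall>N\<ge>1. \<forall>X U u. finite (X :: (int ^ 'd) set) \<and> X \<noteq> {} \<and> limit_potential X U u \<and> cap N X \<le> C0 \<longrightarrow>
    (\<exists>x\<in>X. lap u x > c / real N powr (1 / real CARD('d)))"
proof -
  define d where "d = real CARD('d)"
  define w where "w = unit_ball_vol d"
  have d: "d \<ge> 3" using d3 by (simp add: d_def)
  have w: "w > 0" using d by (simp add: w_def)
  \<comment> \<open>Collects the constants of the final chain, which then reads M^d \<le> K M^2. For
    d \<ge> 3 this contradicts M > K.\<close>
  define K where "K = 6 * C0 * 2 ^ CARD('d) / w"
  define M where "M = 2 * d + K"
  have K: "K > 0" using C0 w by (simp add: K_def)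
  have M: "M > K" "M \<ge> 2 * d" using d K by (simp_all add: M_def)
  \<comment> \<open>Points of norm at most r = M s have l1 norm at most d r. With differences of at
    most c / s, the potential drops by at most d M c = 1 / 2 on the way there.\<close>
  define c where "c = 1 / (2 * d * M)"
  have c: "c > 0" using d M by (simp add: c_def)
  moreover have "\<exists>x\<in>X. lap u x > c / real N powr (1 / real CARD('d))"
    if N: "N \<ge> 1" and X: "finite X" "X \<noteq> {}" and lim: "limit_potential X U u"
        and cap: "cap N X \<le> C0"
    for N and X :: "(int ^ 'd) set" and U u
  proof (rule ccontr)
    define s where "s = real N powr (1 / real CARD('d))"
    note s = side_length[OF N, where 'd = 'd, folded s_def]
    assume "\<not> (\<exists>x\<in>X. lap u x > c / real N powr (1 / real CARD('d)))"
    then have H: "lap u x \<le> c / s" if "x \<in> X" for x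
      using that by (auto simp: s_def not_less)
    define r where "r = M * s"
    have r: "r \<ge> 2 * d" "r > 0"
      using mult_mono[OF M(2) s(1)] d M by (simp_all add: r_def)
    obtain x0 where x0: "x0 \<in> X" using X(2) by blast
    let ?F = "{y :: int ^ 'd. norm (real_vec y) \<le> r}"
    have finF: "finite ?F"
      using finite_bounded_lattice[of "0 :: int ^ 'd" r] by simp
    have half: "u (y + x0) \<ge> 1 / 2" if "y \<in> ?F" for y
    proof -
      have "u x0 - u (x0 + y) \<le> c / s * real_of_int (\<Sum>k\<in>UNIV. \<bar>y $ k\<bar>)"
        using limit_potential_lipschitz[OF X(1) lim _ H] c s(1) by (intro l1_lipschitz) auto
      also have "\<dots> \<le> c / s * (\<Sum>k\<in>(UNIV :: 'd set). r)"
      proof (rule mult_left_mono)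
        have "\<bar>real_of_int (y $ k)\<bar> \<le> r" for k
          using component_le_norm_cart[of "real_vec y" k] that by simp
        then show "real_of_int (\<Sum>k\<in>UNIV. \<bar>y $ k\<bar>)
            \<le> (\<Sum>k\<in>(UNIV :: 'd set). r)"
          by (simp only: of_int_sum of_int_abs sum_mono)
      qed (use c s(1) in simp)
      also have "c / s * (\<Sum>k\<in>(UNIV :: 'd set). r) = 1 / 2"
        using s(1) d M by (simp add: c_def r_def flip: d_def)
      finally show ?thesis
        using limit_potential_eq_1[OF X(1) lim x0] by (simp add: add.commute)
    qed
    \<comment> \<open>The lower bound \<open>M \<ge> 2 * d\<close> was imposed to have r - d \<ge> r
      / 2 here.\<close>
    have "w * (r / 2) ^ CARD('d) \<le> w * (r - d) ^ CARD('d)"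
      using w r d by (intro mult_left_mono power_mono) auto
    also have "\<dots> \<le> real (card {y :: int ^ 'd. norm (real_vec y) < r})"
      using volume_le_card[of r, where 'd = 'd] r d by (simp add: w_def d_def)
    also have "\<dots> \<le> real (card ?F)"
      using finF by (intro of_nat_mono card_mono) auto
    also have "\<dots> = 4 * (\<Sum>y\<in>?F. (1 / 2) ^ 2)"
      by (simp add: power2_eq_square)
    also have "\<dots> \<le> 4 * (\<Sum>y\<in>?F. u (y + x0) ^ 2)"
      using half by (intro mult_left_mono sum_mono power_mono) auto
    also have "(\<Sum>y\<in>?F. u (y + x0) ^ 2) \<le> 3 * r ^ 2 * (\<Sum>x\<in>X. lap u x)"
    proof (rule LIMSEQ_le)
      show "(\<lambda>n. \<Sum>y\<in>?F. U n (y + x0) ^ 2) \<longlonglongrightarrow> (\<Sum>y\<in>?F. u (y + x0) ^ 2)"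
        by (intro tendsto_intros limit_potential_approx[OF X(1) lim])
      show "(\<lambda>n. 3 * r ^ 2 * dirichlet (U n)) \<longlonglongrightarrow> 3 * r ^ 2 * (\<Sum>x\<in>X. lap u x)"
        by (intro tendsto_intros tendsto_dirichlet_approx[OF X(1) lim])
      have "(\<Sum>y\<in>?F. U n (y + x0) ^ 2) \<le> 3 * r ^ 2 * dirichlet (U n)" for n
      proof -
        have "supp (\<lambda>y. U n (y + x0)) = (\<lambda>y. y - x0) ` supp (U n)"
          by (force simp: supp_def)
        then have "finite (supp (\<lambda>y. U n (y + x0)))"
          using finite_supp_approx[OF X(1) lim] by simp
        then show ?thesis
          using sum_sq_le_dirichlet[OF d3, of r "\<lambda>y. U n (y + x0)"] r d
            by (simp add: dirichlet_shift)
      qed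
      then show "\<exists>n0. \<forall>n\<ge>n0. (\<Sum>y\<in>?F. U n (y + x0) ^ 2)
          \<le> 3 * r ^ 2 * dirichlet (U n)"
        by blast
    qed
    also have "(\<Sum>x\<in>X. lap u x) \<le> C0 * real N / (2 * s ^ 2)"
      using cap cap_eq_flux[OF X(1) lim N] s(1) N unfolding s(3) by (simp add: field_simps)
    finally have "w * (r / 2) ^ CARD('d) \<le> 4 * (3 * r ^ 2 * (C0 * real N / (2 * s ^ 2)))"
      using r by simp
    also have "\<dots> = 6 * C0 * M ^ 2 * s ^ CARD('d)"
      using s(1) by (simp add: r_def power_mult_distrib s(2))
    finally have "w * M ^ CARD('d) \<le> 6 * C0 * 2 ^ CARD('d) * M ^ 2"
      using s(1) by (simp add: r_def power_mult_distrib power_divide field_simps)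
    then have "M ^ CARD('d) \<le> K * M ^ 2"
      using w by (simp add: K_def field_simps)
    moreover have "M ^ CARD('d) \<ge> M * M ^ 2"
      using power_increasing[OF d3, of M] d M by (simp add: power3_eq_cube power2_eq_square)
    ultimately have "M * M ^ 2 \<le> K * M ^ 2" by linarith
    then show False
      using M d by simp
  qed
  ultimately show ?thesis by blast
qed

text \<open>The swap is tested on the approximations \<open>U n\<close>, whose distance from the
  capacity is a slack that disappears in the limit.\<close>

lemma limit_swap_inequality:
  fixes X :: "(int ^ 'd) set"
  assumes N: "N \<ge> 1" and X: "finite X" "card X = N" and lim: "limit_potential X U u"
    and min: "cap N X = min_cap TYPE('d) N" and i: "i \<in> X" and j: "j \<notin> X"
  shows "lap u i \<le> 4 * real CARD('d) * (1 - u j)"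
proof -
  define K where "K = 4 * real CARD('d)"
  have K: "K > 0" by (simp add: K_def)
  define a where "a = 2 * real N powr ((2 - real CARD('d)) / real CARD('d))"
  have a: "a > 0" using N by (simp add: a_def)
  have energy: "energy N v = a * dirichlet v" if "finite (supp v)" for v :: "int ^ 'd \<Rightarrow> real"
    using that by (simp add: energy_eq_dirichlet a_def)
  \<comment> \<open>Excess of \<open>U n\<close> over the capacity, in units of the Dirichlet form.
    Minimality of \<open>X\<close> makes it an admissible slack, since the swapped set has no
    smaller capacity.\<close>
  define \<eta> where "\<eta> = (\<lambda>n. dirichlet (U n) - cap N X / a)"
  have "(\<lambda>n. dirichlet (U n) - cap N X / a) \<longlonglongrightarrow> (\<Sum>x\<in>X. lap u x) - cap N X / a"
    by (intro tendsto_intros tendsto_dirichlet_approx[OF X(1) lim])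
  moreover have "cap N X = a * (\<Sum>x\<in>X. lap u x)"
    using cap_eq_flux[OF X(1) lim N] by (simp add: a_def)
  ultimately have \<eta>: "\<eta> \<longlonglongrightarrow> 0"
    using a by (simp add: \<eta>_def)
  have "eventually (\<lambda>n. {j} \<subseteq> exhaustion X n) sequentially"
    by (rule eventually_subset_exhaustion) simp
  then have ev: "eventually (\<lambda>n. lap (U n) i ^ 2
      \<le> K ^ 2 * (1 - U n j) ^ 2 + K * \<eta> n) sequentially"
  proof eventually_elim
    case (elim n)
    show ?case
      unfolding K_def
    proof (rule swap_inequality[OF finite_exhaustion[OF X(1)] subset_exhaustion
          limit_potential_approx(1)[OF X(1) lim] i])
      show "j \<in> exhaustion X n - X" using elim j by simp
      fix v :: "int ^ 'd \<Rightarrow> real"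
      assume v: "supp v \<subseteq> exhaustion X n" "\<And>x. x \<in> insert j (X - {i}) \<Longrightarrow> v x \<ge> 1"
      have fv: "finite (supp v)"
        using v(1) finite_exhaustion[OF X(1)] finite_subset by blast
      have "cap N X \<le> cap N (insert j (X - {i}))"
        unfolding min using X card_swap[OF X(1) i j] by (intro min_cap_le) auto
      also have "\<dots> \<le> energy N v"
        using fv v(2) by (rule cap_le)
      finally have "cap N X / a \<le> dirichlet v"
        using a by (simp add: energy[OF fv] field_simps)
      then show "dirichlet (U n) - \<eta> n \<le> dirichlet v"
        by (simp add: \<eta>_def)
    qed
  qed
  have "(\<lambda>n. lap (U n) i ^ 2) \<longlonglongrightarrow> lap u i ^ 2"
    by (intro tendsto_intros tendsto_lap_limit_potential[OF X(1) lim])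
  moreover have "(\<lambda>n. K ^ 2 * (1 - U n j) ^ 2 + K * \<eta> n) \<longlonglongrightarrow> K ^ 2 * (1 - u j) ^ 2 + K * 0"
    by (intro tendsto_intros limit_potential_approx(2)[OF X(1) lim] \<eta>)
  ultimately have "lap u i ^ 2 \<le> K ^ 2 * (1 - u j) ^ 2 + K * 0"
    using ev by (intro tendsto_le[OF sequentially_bot])
  then have "lap u i ^ 2 \<le> (K * (1 - u j)) ^ 2"
    by (simp add: power_mult_distrib)
  then show ?thesis
    unfolding K_def[symmetric]
    by (rule power2_le_imp_le) (use K limit_potential_range(2)[OF X(1) lim, of j] in simp)
qed

lemma ex_min_cap_bound: "\<exists>C>0. \<forall>N\<ge>1. min_cap TYPE('d::finite) N \<le> C"
proof -
  obtain t where t: "t > 0" "unit_ball_vol (real CARD('d)) * t ^ CARD('d) = 1"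
    using unit_volume_radius[where 'd = 'd] by blast
  \<comment> \<open>Since s \<ge> 1, the surplus d s covers the rounding error \<open>d\<close> of
    the point count for every N, without a threshold on s.\<close>
  define R where "R = t + real CARD('d)"
  have R: "0 < R" "R < R + 1"
    using t by (simp_all add: R_def add_pos_nonneg)
  obtain C where C: "C > 0" "\<And>N. N \<ge> 1 \<Longrightarrow> \<exists>v :: int ^ 'd \<Rightarrow> real. supp v \<subseteq> lattice_ball N (R + 1) \<and>
      (\<forall>x\<in>lattice_ball N R. v x \<ge> 1) \<and> energy N v \<le> C"
    using ex_cutoff[OF R, where 'd = 'd] by blast
  have "min_cap TYPE('d) N \<le> C" if N: "N \<ge> 1" for N
  proof -
    define s where "s = real N powr (1 / real CARD('d))"
    note s = side_length[OF N, where 'd = 'd, folded s_def]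
    have "t * s \<le> R * s - real CARD('d)"
      using mult_left_mono[OF s(1), of "real CARD('d)"] by (simp add: R_def algebra_simps)
    then have "N \<le> card (lattice_ball N R :: (int ^ 'd) set)"
      unfolding s_def by (rule card_lattice_ball_ge[OF N t])
    then obtain X0 :: "(int ^ 'd) set" where X0: "X0 \<subseteq> lattice_ball N R" "card X0
        = N" "finite X0"
      by (meson obtain_subset_with_card_n)
    obtain v :: "int ^ 'd \<Rightarrow> real" where v: "supp v \<subseteq> lattice_ball N (R + 1)"
        "\<forall>x\<in>lattice_ball N R. v x \<ge> 1" "energy N v \<le> C"
      using C(2)[OF N] by blast
    have "min_cap TYPE('d) N \<le> cap N X0"
      using X0 by (intro min_cap_le) auto
    also have "\<dots> \<le> energy N v"
      using v X0 finite_subset[OF v(1) finite_lattice_ball] by (intro cap_le) auto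
    finally show ?thesis using v(3) by simp
  qed
  with C(1) show ?thesis by blast
qed

lemma scaled_perimeter_minimiser:
  assumes d3: "CARD('d) \<ge> 3"
  shows "\<exists>C>0. \<forall>N\<ge>1. \<forall>X :: (int ^ 'd) set. finite X \<and> card X
      = N \<longrightarrow>
    cap N X = min_cap TYPE('d) N \<longrightarrow> scaled_perimeter N X \<le> C"
proof -
  obtain C0 where C0: "C0 > 0" "\<And>N. N \<ge> 1 \<Longrightarrow> min_cap TYPE('d) N \<le> C0"
    using ex_min_cap_bound[where 'd = 'd] by blast
  obtain c where c: "c > 0" and large: "\<forall>N\<ge>1. \<forall>X U u. finite (X :: (int ^ 'd) set) \<and> X \<noteq> {} \<and>
      limit_potential X U u \<and> cap N X \<le> C0
          \<longrightarrow> (\<exists>x\<in>X. lap u x > c / real N powr (1 / real CARD('d)))"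
    using ex_large_flux[OF d3 C0(1)] by (elim exE conjE) (rule that)
  define h where "h = c / (4 * real CARD('d))"
  have h: "h > 0" using c by (simp add: h_def)
  have "scaled_perimeter N X \<le> C0 / 2 / h"
    if N: "N \<ge> 1" and X: "finite X" "card X = N" and min: "cap N X = min_cap TYPE('d) N"
    for N and X :: "(int ^ 'd) set"
  proof -
    define s where "s = real N powr (1 / real CARD('d))"
    note s = side_length[OF N, where 'd = 'd, folded s_def]
    obtain U u where lim: "limit_potential X U u"
      using ex_limit_potential[OF X(1)] by blast
    have cap: "cap N X \<le> C0" using C0(2)[OF N] min by simp
    have "X \<noteq> {}" using X N by auto
    then obtain x where x: "x \<in> X" "lap u x > c / s"
      using large[rule_format, of N X U u] N X(1) lim cap by (auto simp: s_def)
    have "h \<le> s * (1 - u j)" if "j \<notin> X" for j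
    proof -
      have "c / s \<le> 4 * real CARD('d) * (1 - u j)"
        using limit_swap_inequality[OF N X lim min x(1) that] x(2) by linarith
      then show ?thesis
        using s(1) by (simp add: h_def field_simps)
    qed
    moreover have "s ^ 2 / real N * (\<Sum>x\<in>X. lap u x) \<le> C0 / 2"
      using cap cap_eq_flux[OF X(1) lim N] by (simp add: s(3) mult_ac)
    ultimately show ?thesis
      using X limit_potential_range[OF X(1) lim] limit_potential_eq_1[OF X(1) lim] h
      unfolding s_def by (intro scaled_perimeter_le_flux[OF N]) auto
  qed
  moreover have "C0 / 2 / h > 0" using C0(1) h by simp
  ultimately show ?thesis by blast
qed

theorem proposition5p4:
  assumes "CARD('d::finite) \<ge> 3"
  shows "(\<exists>C>0. \<forall>N\<ge>1. \<forall>X :: (int ^ 'd) set.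
            finite X \<and> card X = N \<longrightarrow>
            cap N X = min_cap TYPE('d) N \<longrightarrow>
            scaled_perimeter N X \<le> C) \<and>
         (\<forall>R>0. \<exists>C>0. \<forall>N\<ge>1. \<forall>X :: (int ^ 'd) set.
            X \<subseteq> lattice_ball N R \<and> finite X \<and> card X = N \<longrightarrow>
            rel_cap N X R = min_rel_cap TYPE('d) N R \<longrightarrow>
            scaled_perimeter N X \<le> C)"
proof (intro conjI allI impI)
  show "\<exists>C>0. \<forall>N\<ge>1. \<forall>X :: (int ^ 'd) set. finite X \<and> card X
      = N \<longrightarrow>
      cap N X = min_cap TYPE('d) N \<longrightarrow> scaled_perimeter N X \<le> C"
    by (rule scaled_perimeter_minimiser[OF assms])
next
  fix R :: real assume R: "R > 0"
  show "\<exists>C>0. \<forall>N\<ge>1. \<forall>X :: (int ^ 'd) set. X \<subseteq> lattice_ball N R \<and> finite X \<and> card X = N \<longrightarrow>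
      rel_cap N X R = min_rel_cap TYPE('d) N R \<longrightarrow> scaled_perimeter N X \<le> C"
  \<comment> \<open>The ball of radius R s has N times the volume tested here, so the threshold 1
    decides whether its volume exceeds N.\<close>
  proof (cases "unit_ball_vol (real CARD('d)) * R ^ CARD('d) \<le> 1")
    case True
    then show ?thesis
      using scaled_perimeter_tight_ball[OF R True] by blast
  next
    case False
    then have "unit_ball_vol (real CARD('d)) * R ^ CARD('d) > 1" by simp
    from scaled_perimeter_large_ball[OF R this] show ?thesis by blast
  qed
qed

end
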